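(* Assume Martin's Axiom together with the negation of the Continuum Hypothesis (MA$+\neg$CH). Then a scattered compact Hausdorff space is metrizable if and only if it is separable and hereditarily supercompact.
   Context: A space is scattered if each of its non-empty subspaces has an isolated point. A topological space $X$ is supercompact if it has a subbase $\mathcal B$ of its topology such that each cover of $X$ by elements of $\mathcal B$ has a subcover consisting of at most two elements. A space is hereditarily supercompact if each of its closed subspaces is supercompact. *)

theory Defs
  imports "HOL-Analysis.Analysis" "HOL-Library.Equipollence"
begin

section \<open>Martin's Axiom and the Continuum Hypothesis\<close>

text \<open>A forcing notion is a carrier \<open>P\<close> with a partial order \<open>r\<close> on it; \<open>(p, q) \<in> r\<close> means
  \<open>p \<le> q\<close>, i.e. \<open>p\<close> extends \<open>q\<close>.\<close>

definition compatible_in :: "'p set \<Rightarrow> 'p rel \<Rightarrow> 'p \<Rightarrow> 'p \<Rightarrow> bool" where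
  "compatible_in P r p q \<longleftrightarrow> (\<exists>s\<in>P. (s, p) \<in> r \<and> (s, q) \<in> r)"

definition ccc_order :: "'p set \<Rightarrow> 'p rel \<Rightarrow> bool" where
  "ccc_order P r \<longleftrightarrow>
     (\<forall>A\<subseteq>P. (\<forall>p\<in>A. \<forall>q\<in>A. p \<noteq> q \<longrightarrow> \<not> compatible_in P r p q) \<longrightarrow> countable A)"

definition dense_in_order :: "'p set \<Rightarrow> 'p rel \<Rightarrow> 'p set \<Rightarrow> bool" where
  "dense_in_order P r D \<longleftrightarrow> D \<subseteq> P \<and> (\<forall>p\<in>P. \<exists>d\<in>D. (d, p) \<in> r)"

definition filter_in_order :: "'p set \<Rightarrow> 'p rel \<Rightarrow> 'p set \<Rightarrow> bool" where
  "filter_in_order P r G \<longleftrightarrow> G \<subseteq> P \<and> G \<noteq> {} \<and>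
     (\<forall>p\<in>G. \<forall>q\<in>P. (p, q) \<in> r \<longrightarrow> q \<in> G) \<and>
     (\<forall>p\<in>G. \<forall>q\<in>G. \<exists>s\<in>G. (s, p) \<in> r \<and> (s, q) \<in> r)"

text \<open>Martin's Axiom for the partial orders whose elements are drawn from the type \<open>'p\<close>.  A
  formula of HOL cannot quantify over all types, but nothing is lost by taking \<open>'p\<close> to be
  \<^typ>\<open>real\<close>: the lemma \<open>martins_axiom_real_imp\<close> below derives the axiom for every other type
  from that instance.\<close>

definition martins_axiom :: "'p itself \<Rightarrow> bool" where
  "martins_axiom (_ :: 'p itself) \<longleftrightarrow>
     (\<forall>(P :: 'p set) r \<D>.
        P \<noteq> {} \<and> partial_order_on P r \<and> ccc_order P r \<and>
        (\<forall>D\<in>\<D>. dense_in_order P r D) \<and> \<D> \<prec> (UNIV :: real set) \<longrightarrow>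
        (\<exists>G. filter_in_order P r G \<and> (\<forall>D\<in>\<D>. G \<inter> D \<noteq> {})))"

definition continuum_hypothesis :: bool where
  "continuum_hypothesis \<longleftrightarrow> (\<forall>A :: real set. countable A \<or> A \<approx> (UNIV :: real set))"

lemma martins_axiom_real_imp:
  assumes MA: "martins_axiom TYPE(real)"
  shows "martins_axiom TYPE('p)"
  unfolding martins_axiom_def
proof (intro allI impI, elim conjE)
  include cardinal_syntax
  fix P :: "'p set" and r :: "'p rel" and \<D> :: "'p set set"
  assume ne: "P \<noteq> {}" and po: "partial_order_on P r" and ccc: "ccc_order P r"
    and dense: "\<forall>D\<in>\<D>. dense_in_order P r D" and small: "\<D> \<prec> (UNIV :: real set)"
  have rsub: "r \<subseteq> P \<times> P" and rfl: "\<And>p. p \<in> P \<Longrightarrow> (p, p) \<in> r" and tr: "trans r" and as: "antisym r"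
    using po by (auto simp: partial_order_on_def preorder_on_def refl_on_def)
  obtain p0 where p0: "p0 \<in> P" using ne by blast
  have "\<forall>D p. \<exists>d. D \<in> \<D> \<and> p \<in> P \<longrightarrow> d \<in> D \<and> (d, p) \<in> r"
    using dense unfolding dense_in_order_def by blast
  then obtain f where f: "\<And>D p. D \<in> \<D> \<Longrightarrow> p \<in> P \<Longrightarrow> f D p \<in> D \<and> (f D p, p) \<in> r"
    by metis
  have "\<forall>p q. \<exists>s. p \<in> P \<and> q \<in> P \<longrightarrow> s \<in> P \<and> (compatible_in P r p q \<longrightarrow> (s, p) \<in> r \<and> (s, q) \<in> r)"
    unfolding compatible_in_def by blast
  then obtain g where g: "\<And>p q. p \<in> P \<Longrightarrow> q \<in> P \<Longrightarrow>
      g p q \<in> P \<and> (compatible_in P r p q \<longrightarrow> (g p q, p) \<in> r \<and> (g p q, q) \<in> r)"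
    by metis
  define step where
    "step S = S \<union> (\<lambda>(D, p). f D p) ` (\<D> \<times> S) \<union> (\<lambda>(p, q). g p q) ` (S \<times> S)" for S
  define Qn where "Qn n = (step ^^ n) {p0}" for n
  define Q where "Q = (\<Union>n. Qn n)"
  have Qn_Suc: "Qn (Suc n) = step (Qn n)" for n by (simp add: Qn_def)
  have mono: "Qn m \<subseteq> Qn n" if "m \<le> n" for m n
    using that by (rule lift_Suc_mono_le[rotated]) (auto simp: Qn_Suc step_def)
  have f': "f D p \<in> P" if "D \<in> \<D>" "p \<in> P" for D p
    using f[OF that] rsub by blast
  have QnP: "Qn n \<subseteq> P" for n
  proof (induction n)
    case 0 then show ?case using p0 by (simp add: Qn_def)
  next
    case (Suc n) then show ?case using f' g by (fastforce simp: Qn_Suc step_def)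
  qed
  then have QP: "Q \<subseteq> P" unfolding Q_def by blast
  have p0Q: "p0 \<in> Q" unfolding Q_def Qn_def by (auto intro!: exI[of _ 0])
  have fQ: "f D p \<in> Q" if D: "D \<in> \<D>" and p: "p \<in> Q" for D p
  proof -
    obtain n where "p \<in> Qn n" using p unfolding Q_def by blast
    then have "f D p \<in> Qn (Suc n)" using D unfolding Qn_Suc step_def by force
    then show ?thesis unfolding Q_def by blast
  qed
  have gQ: "g p q \<in> Q" if p: "p \<in> Q" and q: "q \<in> Q" for p q
  proof -
    obtain m n where "p \<in> Qn m" "q \<in> Qn n" using p q unfolding Q_def by blast
    then have "p \<in> Qn (max m n)" "q \<in> Qn (max m n)" using mono by (meson max.cobounded1 max.cobounded2 subsetD)+
    then have "g p q \<in> Qn (Suc (max m n))" unfolding Qn_Suc step_def by force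
    then show ?thesis unfolding Q_def by blast
  qed
  let ?R = "UNIV :: real set"
  have inf: "infinite ?R" by (rule infinite_UNIV_char_0)
  then have infF: "infinite (Field |?R| )" by (simp add: Field_card_of)
  have \<D>R: "|\<D>| \<le>o |?R|"
    using small card_of_ordLeq[of \<D> ?R] unfolding lesspoll_def lepoll_def by blast
  have QnR: "|Qn n| \<le>o |?R|" for n
  proof (induction n)
    case 0
    have "\<exists>h. inj_on h {p0} \<and> h ` {p0} \<subseteq> ?R" by auto
    then show ?case using card_of_ordLeq[of "{p0}" ?R] by (simp add: Qn_def)
  next
    case (Suc n)
    have "|\<D> \<times> Qn n| \<le>o |?R|"
      by (intro card_of_Times_ordLeq_infinite_Field[OF infF _ _ card_of_Card_order] Suc \<D>R)
    then have F: "|(\<lambda>(D, p). f D p) ` (\<D> \<times> Qn n)| \<le>o |?R|"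
      by (rule ordLeq_transitive[OF card_of_image])
    have "|Qn n \<times> Qn n| \<le>o |?R|"
      by (intro card_of_Times_ordLeq_infinite_Field[OF infF _ _ card_of_Card_order] Suc)
    then have G: "|(\<lambda>(p, q). g p q) ` (Qn n \<times> Qn n)| \<le>o |?R|"
      by (rule ordLeq_transitive[OF card_of_image])
    show ?case unfolding Qn_Suc step_def
      by (intro card_of_Un_ordLeq_infinite_Field[OF infF _ _ card_of_Card_order] Suc F G)
  qed
  have "|UNIV :: nat set| \<le>o |?R|"
    using inf infinite_iff_card_of_nat by blast
  then have "|Q| \<le>o |?R|"
    unfolding Q_def using QnR inf by (intro card_of_UNION_ordLeq_infinite) auto
  then obtain h :: "'p \<Rightarrow> real" where h: "inj_on h Q"
    using card_of_ordLeq[of Q ?R] by auto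
  have heq: "h a = h b \<longleftrightarrow> a = b" if "a \<in> Q" "b \<in> Q" for a b
    using h that by (auto dest: inj_onD)
  define r' where "r' = (\<lambda>(a, b). (h a, h b)) ` (r \<inter> Q \<times> Q)"
  have r': "(h a, h b) \<in> r' \<longleftrightarrow> (a, b) \<in> r" if "a \<in> Q" "b \<in> Q" for a b
  proof
    assume "(h a, h b) \<in> r'"
    then obtain c d where "(c, d) \<in> r" "c \<in> Q" "d \<in> Q" "h a = h c" "h b = h d"
      unfolding r'_def by auto
    then show "(a, b) \<in> r" using that heq by blast
  next
    assume "(a, b) \<in> r"
    then show "(h a, h b) \<in> r'" using that unfolding r'_def by force
  qed
  have r'E: "\<exists>a\<in>Q. \<exists>b\<in>Q. x = h a \<and> y = h b \<and> (a, b) \<in> r" if "(x, y) \<in> r'" for x y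
    using that by (auto simp: r'_def)
  define \<D>' where "\<D>' = (\<lambda>D. h ` (D \<inter> Q)) ` \<D>"
  have ne': "h ` Q \<noteq> {}" using p0Q by blast
  have po': "partial_order_on (h ` Q) r'"
    unfolding partial_order_on_def preorder_on_def refl_on_def
  proof (intro conjI)
    show "r' \<subseteq> h ` Q \<times> h ` Q" by (auto simp: r'_def)
    show "\<forall>x\<in>h ` Q. (x, x) \<in> r'" using r' rfl subsetD[OF QP] by simp
    show "trans r'"
    proof (rule transI)
      fix x y z assume "(x, y) \<in> r'" "(y, z) \<in> r'"
      then obtain a b c d where abcd: "a \<in> Q" "b \<in> Q" "c \<in> Q" "d \<in> Q" "x = h a" "y = h b" "y = h c" "z = h d"
        "(a, b) \<in> r" "(c, d) \<in> r"
        using r'E[of x y] r'E[of y z] by blast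
      then have "b = c" using heq[of b c] by simp
      then have "(a, d) \<in> r" using abcd transD[OF tr, of a b d] by blast
      then show "(x, z) \<in> r'" using abcd r' by simp
    qed
    show "antisym r'"
    proof (rule antisymI)
      fix x y assume xy: "(x, y) \<in> r'" "(y, x) \<in> r'"
      then obtain a b where ab: "a \<in> Q" "b \<in> Q" "x = h a" "y = h b" "(a, b) \<in> r"
        using r'E[of x y] by blast
      then have "(b, a) \<in> r" using xy r' by simp
      then show "x = y" using ab antisymD[OF as, of a b] by blast
    qed
  qed
  have comp: "compatible_in (h ` Q) r' (h p) (h q)"
    if "p \<in> Q" "q \<in> Q" "compatible_in P r p q" for p q
  proof -
    have "(g p q, p) \<in> r" "(g p q, q) \<in> r" using g[of p q] that QP by blast+
    moreover have "g p q \<in> Q" using gQ that by blast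
    ultimately show ?thesis
      unfolding compatible_in_def using that r'[of "g p q" p] r'[of "g p q" q] by blast
  qed
  have ccc': "ccc_order (h ` Q) r'"
    unfolding ccc_order_def
  proof (intro allI impI)
    fix A assume A: "A \<subseteq> h ` Q"
      and anti: "\<forall>x\<in>A. \<forall>y\<in>A. x \<noteq> y \<longrightarrow> \<not> compatible_in (h ` Q) r' x y"
    define B where "B = {p \<in> Q. h p \<in> A}"
    have "\<not> compatible_in P r p q" if "p \<in> B" "q \<in> B" "p \<noteq> q" for p q
    proof -
      have "h p \<in> A" "h q \<in> A" "h p \<noteq> h q" "p \<in> Q" "q \<in> Q"
        using that heq[of p q] unfolding B_def by simp_all
      then show ?thesis using anti comp[of p q] by blast
    qed
    moreover have "B \<subseteq> P" using QP unfolding B_def by blast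
    ultimately have "countable B"
      by (intro ccc[unfolded ccc_order_def, rule_format]) auto
    moreover have "A = h ` B" using A unfolding B_def by blast
    ultimately show "countable A" by simp
  qed
  have dense': "\<forall>E\<in>\<D>'. dense_in_order (h ` Q) r' E"
    unfolding \<D>'_def dense_in_order_def
  proof (intro ballI conjI)
    fix E assume E: "E \<in> (\<lambda>D. h ` (D \<inter> Q)) ` \<D>"
    then show "E \<subseteq> h ` Q" by blast
    fix x assume "x \<in> h ` Q"
    then obtain p where p: "p \<in> Q" "x = h p" by blast
    obtain D where D: "D \<in> \<D>" "E = h ` (D \<inter> Q)" using E by blast
    have "f D p \<in> D" "(f D p, p) \<in> r" using f[of D p] D p QP by blast+
    moreover have "f D p \<in> Q" using fQ D p by blast
    ultimately show "\<exists>d\<in>E. (d, x) \<in> r'" using D p r'[of "f D p" p] by blast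
  qed
  have "\<D>' \<prec> ?R"
    unfolding \<D>'_def by (rule lesspoll_trans1[OF image_lepoll small])
  then have "\<exists>G'. filter_in_order (h ` Q) r' G' \<and> (\<forall>E\<in>\<D>'. G' \<inter> E \<noteq> {})"
    using ne' po' ccc' dense' by (intro MA[unfolded martins_axiom_def, rule_format] conjI ballI) auto
  then obtain G' where G': "filter_in_order (h ` Q) r' G'" "\<forall>E\<in>\<D>'. G' \<inter> E \<noteq> {}"
    by blast
  have G'sub: "G' \<subseteq> h ` Q" and G'ne: "G' \<noteq> {}"
    and G'dir: "\<And>x y. x \<in> G' \<Longrightarrow> y \<in> G' \<Longrightarrow> \<exists>s\<in>G'. (s, x) \<in> r' \<and> (s, y) \<in> r'"
    using G'(1) unfolding filter_in_order_def by blast+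
  define G where "G = {p \<in> P. \<exists>q\<in>Q. h q \<in> G' \<and> (q, p) \<in> r}"
  have "filter_in_order P r G"
    unfolding filter_in_order_def
  proof (intro conjI ballI impI)
    show "G \<subseteq> P" unfolding G_def by blast
    show "G \<noteq> {}" using G'sub G'ne QP rfl unfolding G_def by blast
    show "q \<in> G" if "p \<in> G" "q \<in> P" "(p, q) \<in> r" for p q
      using that transD[OF tr, of _ p q] unfolding G_def by blast
    show "\<exists>s\<in>G. (s, p) \<in> r \<and> (s, q) \<in> r" if pq: "p \<in> G" "q \<in> G" for p q
    proof -
      obtain a b where ab: "a \<in> Q" "h a \<in> G'" "(a, p) \<in> r" "b \<in> Q" "h b \<in> G'" "(b, q) \<in> r"
        using pq unfolding G_def by blast
      obtain x where x: "x \<in> G'" "(x, h a) \<in> r'" "(x, h b) \<in> r'" using G'dir ab by blast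
      then obtain s where s: "s \<in> Q" "x = h s" using G'sub by blast
      then have "(s, a) \<in> r" "(s, b) \<in> r" using x ab r'[of s a] r'[of s b] by simp_all
      then have "(s, p) \<in> r" "(s, q) \<in> r"
        using ab transD[OF tr, of s a p] transD[OF tr, of s b q] by blast+
      moreover have "s \<in> G" using s x QP rfl unfolding G_def by blast
      ultimately show ?thesis by blast
    qed
  qed
  moreover have "G \<inter> D \<noteq> {}" if D: "D \<in> \<D>" for D
  proof -
    have "G' \<inter> h ` (D \<inter> Q) \<noteq> {}" using G'(2) D unfolding \<D>'_def by blast
    then obtain q where "q \<in> D" "q \<in> Q" "h q \<in> G'" by blast
    then have "q \<in> G \<inter> D" using QP rfl unfolding G_def by blast
    then show ?thesis by blast
  qed
  ultimately show "\<exists>G. filter_in_order P r G \<and> (\<forall>D\<in>\<D>. G \<inter> D \<noteq> {})" by blast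
qed

section \<open>Scattered and hereditarily supercompact spaces\<close>

definition scattered_space :: "'a topology \<Rightarrow> bool" where
  "scattered_space X \<longleftrightarrow>
     (\<forall>S \<subseteq> topspace X. S \<noteq> {} \<longrightarrow> (\<exists>x\<in>S. openin (subtopology X S) {x}))"

text \<open>The empty intersection counts as the whole space, so a subbase need not cover the space.\<close>

definition subbase_of :: "'a set set \<Rightarrow> 'a topology \<Rightarrow> bool" where
  "subbase_of \<B> X \<longleftrightarrow> \<B> \<subseteq> Pow (topspace X) \<and>
     openin X = arbitrary union_of (finite intersection_of (\<lambda>U. U \<in> \<B>) relative_to topspace X)"

definition supercompact_space :: "'a topology \<Rightarrow> bool" where
  "supercompact_space X \<longleftrightarrow>
     (\<exists>\<B>. subbase_of \<B> X \<and>
        (\<forall>\<U> \<subseteq> \<B>. \<Union>\<U> = topspace X \<longrightarrow>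
           (\<exists>\<V> \<subseteq> \<U>. finite \<V> \<and> card \<V> \<le> 2 \<and> \<Union>\<V> = topspace X)))"

definition hereditarily_supercompact_space :: "'a topology \<Rightarrow> bool" where
  "hereditarily_supercompact_space X \<longleftrightarrow>
     (\<forall>S. closedin X S \<longrightarrow> supercompact_space (subtopology X S))"

end

theory Submission
  imports Defs
begin

text \<open>A scattered compact Hausdorff space is zero-dimensional.  If it is metrizable, it has only
  countably many clopen sets, and these are refined by a tree of clopen sets whose complements form a
  binary subbase; this applies to every closed subspace as well.

  Conversely, Bell's theorem says that a closed set with countable dense complement in a supercompact
  space is separable.  Given an uncountable discrete subset, Martin's Axiom yields a set of isolated
  points almost disjointly attached to it, whose closure would violate this; so discrete subsets are
  countable.  Hence the space and its finite powers are countably tight.  If uncountably many points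
  had countable clopen neighbourhoods, the finite partial colourings of these points with discrete
  colour classes would satisfy the countable chain condition, by the Delta-system lemma and tightness,
  and Martin's Axiom would give an uncountable discrete set.  So only countably many points have
  countable neighbourhoods, and by scatteredness these are all the points; a countable
  zero-dimensional compact space is metrizable.\<close>

section \<open>Zero-dimensional compact spaces\<close>

text \<open>Separability only makes the isolated points a countable dense set. The one-point
  compactification of a Psi-space over an uncountable almost disjoint family of sets of naturals is
  separable, scattered and compact, but not metrizable. The first use of Martin's Axiom finds this
  obstacle behind every uncountable discrete set: the remainder of some countable set of isolated
  points then has uncountably many disjoint non-empty relatively open pieces, against Bell's
  theorem. The negation of CH shrinks an uncountable set below the continuum, so that one dense set
  per point is admissible.

  In the second use, points with countable clopen neighbourhoods \<open>V x\<close> form a graph,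
  \<open>x\<close> and \<open>y\<close> being joined if one lies in the neighbourhood of the other;
  independent sets are discrete. The obstacle is the countable chain condition: an uncountable
  antichain yields sets of \<open>n\<close> points, any two of them linked by an edge. Read as
  points of the \<open>n\<close>-th power of the space, they turn linkage into membership in clopen
  sets, where compactness and tightness can act. Hence tightness is needed for finite
  powers.\<close>

lemma closure_of_meets_open:
  "openin X U \<Longrightarrow> z \<in> U \<Longrightarrow> z \<in> X closure_of A \<Longrightarrow> \<exists>a\<in>A. a \<in> U"
  unfolding in_closure_of by blast

definition zero_dimensional_space :: "'a topology \<Rightarrow> bool" where
  "zero_dimensional_space X \<longleftrightarrow>
     (\<forall>U x. openin X U \<and> x \<in> U \<longrightarrow> (\<exists>V. openin X V \<and> closedin X V \<and> x \<in> V \<and> V \<subseteq> U))"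

text \<open>The finite intersection property for \<open>\<C>\<close> together with the complement of
  \<open>O'\<close>. The factor \<open>topspace X\<close> gives the empty subfamily the whole space
  as its intersection.\<close>

lemma compact_space_Inter_subset_open:
  assumes X: "compact_space X" and closed: "\<And>C. C \<in> \<C> \<Longrightarrow> closedin X C"
    and O: "openin X O'" and sub: "topspace X \<inter> \<Inter>\<C> \<subseteq> O'"
  shows "\<exists>\<F>. finite \<F> \<and> \<F> \<subseteq> \<C> \<and> topspace X \<inter> \<Inter>\<F> \<subseteq> O'"
proof (rule ccontr)
  assume con: "\<not> ?thesis"
  define \<U> where "\<U> = insert (topspace X - O') \<C>"
  have "\<forall>C\<in>\<U>. closedin X C" using closed O by (auto simp: \<U>_def)
  moreover have "\<Inter>\<F> \<noteq> {}" if "finite \<F>" "\<F> \<subseteq> \<U>" for \<F>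
  proof -
    have "finite (\<F> \<inter> \<C>)" "\<F> \<inter> \<C> \<subseteq> \<C>" using that by auto
    then obtain y where y: "y \<in> topspace X" "y \<in> \<Inter>(\<F> \<inter> \<C>)" "y \<notin> O'" using con by blast
    then have "y \<in> C" if "C \<in> \<F>" for C using that \<open>\<F> \<subseteq> \<U>\<close> unfolding \<U>_def by auto
    then show ?thesis by blast
  qed
  ultimately have "\<Inter>\<U> \<noteq> {}" using X[unfolded compact_space_fip, rule_format, of \<U>] by blast
  then show False using sub unfolding \<U>_def by blast
qed

lemma finite_Inter_clopen:
  assumes "finite \<F>" and "\<And>C. C \<in> \<F> \<Longrightarrow> openin X C \<and> closedin X C"
  shows "openin X (topspace X \<inter> \<Inter>\<F>) \<and> closedin X (topspace X \<inter> \<Inter>\<F>)"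
  using assms
proof (induction \<F>)
  case (insert C \<F>)
  then have "topspace X \<inter> \<Inter>(insert C \<F>) = C \<inter> (topspace X \<inter> \<Inter>\<F>)" by blast
  then show ?case using insert by (auto intro: openin_Int closedin_Int)
qed auto

text \<open>The quasi-component \<open>Q\<close> of \<open>x\<close> has an isolated point
  \<open>y\<close>. By normality and compactness a clopen set separates \<open>y\<close> from the
  rest of \<open>Q\<close>, but a clopen set contains a quasi-component or misses it; so
  \<open>Q\<close> is a single point.\<close>

lemma scattered_compact_Hausdorff_imp_zero_dimensional:
  assumes sc: "scattered_space X" and comp: "compact_space X" and haus: "Hausdorff_space X"
  shows "zero_dimensional_space X"
  unfolding zero_dimensional_space_def
proof (intro allI impI, elim conjE)
  fix U x assume U: "openin X U" and xU: "x \<in> U"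
  have x: "x \<in> topspace X" using U xU openin_subset by blast
  define \<C> where "\<C> = {C. openin X C \<and> closedin X C \<and> x \<in> C}"
  define Q where "Q = topspace X \<inter> \<Inter>\<C>"
  have clopen_of_open: "\<exists>K. K \<in> \<C> \<and> K \<subseteq> W" if W: "openin X W" "Q \<subseteq> W" for W
  proof -
    obtain \<F> where F: "finite \<F>" "\<F> \<subseteq> \<C>" "topspace X \<inter> \<Inter>\<F> \<subseteq> W"
      using compact_space_Inter_subset_open[OF comp _ W(1), of \<C>] W(2)
      unfolding Q_def \<C>_def by blast
    have "openin X (topspace X \<inter> \<Inter>\<F>) \<and> closedin X (topspace X \<inter> \<Inter>\<F>)"
      using F by (intro finite_Inter_clopen) (auto simp: \<C>_def)
    moreover have "x \<in> topspace X \<inter> \<Inter>\<F>" using F(2) x by (auto simp: \<C>_def)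
    ultimately show ?thesis using F(3) unfolding \<C>_def by blast
  qed
  have Qclosed: "closedin X Q"
  proof -
    have "Q = \<Inter>(insert (topspace X) \<C>)" unfolding Q_def by simp
    also have "closedin X \<dots>" by (rule closedin_Inter) (auto simp: \<C>_def)
    finally show ?thesis .
  qed
  have "x \<in> Q" using x by (auto simp: Q_def \<C>_def)
  then obtain y where y: "y \<in> Q" "openin (subtopology X Q) {y}"
    using sc[unfolded scattered_space_def, rule_format, of Q] unfolding Q_def by blast
  then obtain W where W: "openin X W" "{y} = W \<inter> Q"
    unfolding openin_subtopology by blast
  have "closedin X {y}" using haus y(1) Q_def
    by (metis Hausdorff_imp_t1_space IntD1 t1_space_closedin_singleton)
  moreover have "closedin X (Q - W)" using Qclosed W by blast
  moreover have "disjnt {y} (Q - W)" using W by (auto simp: disjnt_def)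
  ultimately obtain G H where GH: "openin X G" "openin X H" "{y} \<subseteq> G" "Q - W \<subseteq> H" "disjnt G H"
    using comp haus compact_Hausdorff_or_regular_imp_normal_space unfolding normal_space_def by metis
  have "Q \<subseteq> G \<union> H" using GH W by blast
  then obtain K where K: "K \<in> \<C>" "K \<subseteq> G \<union> H"
    using clopen_of_open[of "G \<union> H"] GH by (auto intro: openin_Un)
  \<comment> \<open>The disjoint open sets \<open>G\<close> and \<open>H\<close> split the clopen
    set \<open>K\<close>, so both halves are clopen.\<close>
  have "K \<inter> G = K - H" using K(2) GH(5) by (auto simp: disjnt_def)
  then have KG: "openin X (K \<inter> G)" "closedin X (K \<inter> G)"
    using K GH openin_Int[of X K G] closedin_diff[of X K H] by (simp_all add: \<C>_def)
  have "Q \<subseteq> {x}"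
  proof (cases "x \<in> K \<inter> G")
    case True
    then have "Q \<subseteq> K \<inter> G" using KG by (auto simp: Q_def \<C>_def)
    then have "Q \<subseteq> {y}" using GH W by (auto simp: disjnt_def)
    then show ?thesis using \<open>x \<in> Q\<close> by blast
  next
    case False
    then have "topspace X - K \<inter> G \<in> \<C>" using KG x by (auto simp: \<C>_def)
    then have "y \<notin> K \<inter> G" using y by (auto simp: Q_def)
    then show ?thesis using y GH K by (auto simp: Q_def \<C>_def)
  qed
  then obtain K where "K \<in> \<C>" "K \<subseteq> U" using clopen_of_open[OF U] xU by blast
  then show "\<exists>V. openin X V \<and> closedin X V \<and> x \<in> V \<and> V \<subseteq> U" by (auto simp: \<C>_def)
qed

lemma zero_dimensional_subtopology:
  assumes "zero_dimensional_space X"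
  shows "zero_dimensional_space (subtopology X S)"
  unfolding zero_dimensional_space_def
proof (intro allI impI, elim conjE)
  fix U x assume "openin (subtopology X S) U" and x: "x \<in> U"
  then obtain T where T: "openin X T" "U = T \<inter> S" unfolding openin_subtopology by blast
  then obtain V where "openin X V" "closedin X V" "x \<in> V" "V \<subseteq> T"
    using assms x unfolding zero_dimensional_space_def by blast
  then show "\<exists>V. openin (subtopology X S) V \<and> closedin (subtopology X S) V \<and> x \<in> V \<and> V \<subseteq> U"
    using T x by (intro exI[of _ "V \<inter> S"]) (auto simp: openin_subtopology closedin_subtopology)
qed

section \<open>From compact metrizable to hereditarily supercompact\<close>

lemma compact_metrizable_imp_second_countable:
  assumes "compact_space X" "metrizable_space X"
  shows "second_countable X"
proof -
  obtain M d where Md: "Metric_space M d" "X = Metric_space.mtopology M d"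
    using assms(2) unfolding metrizable_space_def by blast
  interpret Metric_space M d by fact
  have "compactin mtopology M" using assms(1) Md(2) by (simp add: compact_space_def)
  then have tb: "mtotally_bounded M" by (rule compactin_imp_mtotally_bounded)
  have "\<forall>n. \<exists>K. finite K \<and> K \<subseteq> M \<and> M \<subseteq> (\<Union>x\<in>K. mball x (1 / Suc n))"
    using tb unfolding mtotally_bounded_def by simp
  then obtain K where K: "\<And>n. finite (K n)" "\<And>n. K n \<subseteq> M"
      "\<And>n. M \<subseteq> (\<Union>x\<in>K n. mball x (1 / Suc n))" by metis
  define \<B> where "\<B> = (\<Union>n. (\<lambda>x. mball x (1 / Suc n)) ` K n)"
  have "countable \<B>" unfolding \<B>_def using K(1) by (auto intro: countable_finite)
  moreover have "\<forall>V\<in>\<B>. openin X V" by (auto simp: \<B>_def Md(2))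
  moreover have "\<exists>V\<in>\<B>. x \<in> V \<and> V \<subseteq> U" if U: "openin X U" "x \<in> U" for U x
  proof -
    obtain r where r: "r > 0" "mball x r \<subseteq> U" and xM: "x \<in> M"
      using U unfolding Md(2) openin_mtopology by blast
    obtain n where n: "1 / real (Suc n) < r / 2"
      using r nat_approx_posE[of "r/2"] by auto
    obtain c where c: "c \<in> K n" "x \<in> mball c (1 / Suc n)" using K(3)[of n] xM by blast
    have "mball c (1 / Suc n) \<subseteq> mball x r"
    proof
      fix z assume z: "z \<in> mball c (1 / Suc n)"
      have "d x z \<le> d x c + d c z" using z c triangle xM by simp
      then show "z \<in> mball x r" using z c n xM commute[of x c] by auto
    qed
    then show ?thesis using c r unfolding \<B>_def by blast
  qed
  ultimately show ?thesis unfolding second_countable_def by blast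
qed

lemma compact_clopen_finite_Union:
  assumes comp: "compact_space X" and B: "\<And>V. V \<in> \<B> \<Longrightarrow> openin X V"
    and base: "\<And>U x. openin X U \<Longrightarrow> x \<in> U \<Longrightarrow> \<exists>V\<in>\<B>. x \<in> V \<and> V \<subseteq> U"
    and C: "openin X C" "closedin X C"
  shows "\<exists>\<F>. finite \<F> \<and> \<F> \<subseteq> \<B> \<and> C = \<Union>\<F>"
proof -
  have "compactin X C" using comp C closedin_compact_space by blast
  moreover have "C \<subseteq> \<Union>{V\<in>\<B>. V \<subseteq> C}" using base[OF C(1)] by blast
  ultimately obtain \<F> where "finite \<F>" "\<F> \<subseteq> {V\<in>\<B>. V \<subseteq> C}" "C \<subseteq> \<Union>\<F>"
    using B unfolding compactin_def by (metis (no_types, lifting) mem_Collect_eq)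
  then show ?thesis by (intro exI[of _ \<F>]) blast
qed

lemma countable_clopens:
  assumes "compact_space X" "second_countable X"
  shows "countable {C. openin X C \<and> closedin X C}"
proof -
  obtain \<B> where \<B>: "countable \<B>" "\<forall>V\<in>\<B>. openin X V"
    "\<forall>U x. openin X U \<and> x \<in> U \<longrightarrow> (\<exists>V \<in> \<B>. x \<in> V \<and> V \<subseteq> U)"
    using assms(2) unfolding second_countable_def by blast
  have "{C. openin X C \<and> closedin X C} \<subseteq> Union ` {\<F>. finite \<F> \<and> \<F> \<subseteq> \<B>}"
    using compact_clopen_finite_Union[OF assms(1), of \<B>] \<B> by blast
  then show ?thesis
    using countable_image[OF countable_Collect_finite_subset[OF \<B>(1)], of Union] countable_subset by blast
qed

lemma supercompact_space_of_countable_clopens: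
  fixes C :: "nat \<Rightarrow> 'a set"
  assumes comp: "compact_space X" and C: "\<And>n. openin X (C n)" "\<And>n. closedin X (C n)"
    and base: "\<And>U x. openin X U \<Longrightarrow> x \<in> U \<Longrightarrow> \<exists>n. x \<in> C n \<and> C n \<subseteq> U"
  shows "supercompact_space X"
proof -
  \<comment> \<open>The classes \<open>A n x\<close> form a tree under inclusion, so a pairwise intersecting family of them is
    a chain.  The subbase consists of their complements.\<close>
  define A where "A n x = {y \<in> topspace X. \<forall>i<n. y \<in> C i \<longleftrightarrow> x \<in> C i}" for n x
  define \<B> where "\<B> = {topspace X - A n x | n x. x \<in> topspace X}"
  have Aclopen: "openin X (A n x) \<and> closedin X (A n x)" for n x
  proof -
    let ?\<F> = "(\<lambda>i. if x \<in> C i then C i else topspace X - C i) ` {..<n}"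
    have "A n x = topspace X \<inter> \<Inter>?\<F>"
      by (auto simp: A_def split: if_splits)
    moreover have "openin X (topspace X \<inter> \<Inter>?\<F>) \<and> closedin X (topspace X \<inter> \<Inter>?\<F>)"
    proof (rule finite_Inter_clopen)
      fix D assume "D \<in> ?\<F>"
      then obtain i where "D = C i \<or> D = topspace X - C i" by (auto split: if_splits)
      then show "openin X D \<and> closedin X D"
        using C openin_diff[OF openin_topspace C(2)] closedin_diff[OF closedin_topspace C(1)] by blast
    qed simp
    ultimately show ?thesis by simp
  qed
  have Afin: "finite (range (A n))" for n
  proof -
    have "A n x = (\<lambda>J. {y \<in> topspace X. {i. i < n \<and> y \<in> C i} = J}) {i. i < n \<and> x \<in> C i}" for x
      by (auto simp: A_def)
    then have "range (A n) \<subseteq> (\<lambda>J. {y \<in> topspace X. {i. i < n \<and> y \<in> C i} = J}) ` Pow {..<n}"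
      by blast
    then show ?thesis by (rule finite_subset) auto
  qed
  have sub: "subbase_of \<B> X"
    unfolding subbase_of_def
  proof
    show "\<B> \<subseteq> Pow (topspace X)" by (auto simp: \<B>_def)
    show "openin X = arbitrary union_of (finite intersection_of (\<lambda>U. U \<in> \<B>) relative_to topspace X)"
    proof (rule iffD2[OF openin_topology_base_unique], intro conjI allI impI)
      fix V assume "(finite intersection_of (\<lambda>U. U \<in> \<B>) relative_to topspace X) V"
      then obtain \<F> where "finite \<F>" "\<F> \<subseteq> \<B>" "V = topspace X \<inter> \<Inter>\<F>"
        unfolding relative_to_def intersection_of_def by auto
      moreover have "openin X N \<and> closedin X N" if N: "N \<in> \<F>" for N
      proof -
        obtain n x where "N = topspace X - A n x" using N \<open>\<F> \<subseteq> \<B>\<close> unfolding \<B>_def by blast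
        then show ?thesis using Aclopen[of n x] by auto
      qed
      ultimately show "openin X V" using finite_Inter_clopen[of \<F> X] by simp
    next
      fix U x assume "openin X U \<and> x \<in> U"
      then obtain n where n: "x \<in> C n" "C n \<subseteq> U" and x: "x \<in> topspace X"
        using base[of U x] openin_subset[of X U] by blast
      \<comment> \<open>Removing the finitely many other classes leaves exactly the class of
        \<open>x\<close>. Level \<open>Suc n\<close> is needed because \<open>A n\<close> decides
        only the indices below \<open>n\<close>, and \<open>C n\<close> itself has to be
        decided.\<close>
      define \<F> where "\<F> = (\<lambda>a. topspace X - a) ` ((A (Suc n) ` topspace X) - {A (Suc n) x})"
      have "finite (A (Suc n) ` topspace X)"
        by (rule finite_subset[OF _ Afin[of "Suc n"]]) blast
      then have "finite \<F>" unfolding \<F>_def by simp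
      moreover have "\<F> \<subseteq> \<B>" unfolding \<F>_def \<B>_def by blast
      moreover have "topspace X \<inter> \<Inter>\<F> \<subseteq> U"
      proof
        fix y assume y: "y \<in> topspace X \<inter> \<Inter>\<F>"
        then have "y \<in> A (Suc n) y" by (auto simp: A_def)
        then have "A (Suc n) y = A (Suc n) x" using y unfolding \<F>_def by blast
        then have "y \<in> A (Suc n) x" using \<open>y \<in> A (Suc n) y\<close> by simp
        then show "y \<in> U" using n by (auto simp: A_def)
      qed
      moreover have "x \<in> topspace X \<inter> \<Inter>\<F>"
      proof -
        have "x \<notin> A (Suc n) z" if "A (Suc n) z \<noteq> A (Suc n) x" for z
          using that by (auto simp: A_def)
        then show ?thesis using x unfolding \<F>_def by blast
      qed
      ultimately show "\<exists>V. (finite intersection_of (\<lambda>U. U \<in> \<B>) relative_to topspace X) V \<and> x \<in> V \<and> V \<subseteq> U"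
        unfolding relative_to_def intersection_of_def
        by (intro exI[of _ "topspace X \<inter> \<Inter>\<F>"]) auto
    qed
  qed
  have nested: "A m x \<inter> A n y = {} \<or> A n y \<subseteq> A m x" if "m \<le> n" for m n x y
    using that by (fastforce simp: A_def)
  have two: "\<exists>\<V>\<subseteq>\<U>. finite \<V> \<and> card \<V> \<le> 2 \<and> \<Union>\<V> = topspace X"
    if U: "\<U> \<subseteq> \<B>" "\<Union>\<U> = topspace X" for \<U>
  proof (cases "topspace X = {}")
    case True
    then have "{} \<subseteq> \<U> \<and> finite {} \<and> card {} \<le> 2 \<and> \<Union>{} = topspace X" by simp
    then show ?thesis by blast
  next
    case False
    show ?thesis
    proof (rule ccontr)
      assume con: "\<not> ?thesis"
      define \<N> where "\<N> = (\<lambda>u. topspace X - u) ` \<U>"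
      have \<N>sub: "\<exists>n x. x \<in> topspace X \<and> N = A n x" if N: "N \<in> \<N>" for N
      proof -
        obtain n x where "x \<in> topspace X" "N = topspace X - (topspace X - A n x)"
          using N U(1) unfolding \<N>_def \<B>_def by auto
        moreover have "A n x \<subseteq> topspace X" by (auto simp: A_def)
        ultimately show ?thesis by (metis double_diff order_refl)
      qed
      \<comment> \<open>The case \<open>N = N'\<close> is included: it says that no member is empty,
        which is what the least member of a finite chain needs below.\<close>
      have link: "N \<inter> N' \<noteq> {}" if N: "N \<in> \<N>" "N' \<in> \<N>" for N N'
      proof
        assume e: "N \<inter> N' = {}"
        obtain u v where uv: "u \<in> \<U>" "v \<in> \<U>" "N = topspace X - u" "N' = topspace X - v"
          using N unfolding \<N>_def by blast
        then have "\<Union>{u,v} = topspace X" using e U(2) by auto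
        moreover have "card {u,v} \<le> 2" by (simp add: card_insert_if)
        ultimately show False using con uv by (metis empty_subsetI finite.emptyI finite_insert insert_subset)
      qed
      have chain: "N \<subseteq> N' \<or> N' \<subseteq> N" if N: "N \<in> \<N>" "N' \<in> \<N>" for N N'
      proof -
        obtain m x n y where "N = A m x" "N' = A n y" using N \<N>sub by metis
        then show ?thesis using nested[of m n x y] nested[of n m y x] link[OF N]
          by (metis inf_commute linear)
      qed
      have fin: "topspace X \<inter> \<Inter>\<F> \<noteq> {}" if "finite \<F>" "\<F> \<subseteq> \<N>" for \<F>
      proof (cases "\<F> = {}")
        case True
        then show ?thesis using \<open>topspace X \<noteq> {}\<close> by simp
      next
        case False
        have "\<Inter>\<F> \<in> \<F>" using that(1) False that(2)
        proof (induction \<F> rule: finite_ne_induct)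
          case (insert N \<F>)
          then have "\<Inter>\<F> \<in> \<F>" by simp
          moreover have "N \<subseteq> \<Inter>\<F> \<or> \<Inter>\<F> \<subseteq> N" using insert calculation by (intro chain) auto
          ultimately show ?case by (auto simp: Int_absorb1 Int_absorb2)
        qed auto
        then have N: "\<Inter>\<F> \<in> \<N>" using that(2) by blast
        then have "\<Inter>\<F> \<noteq> {}" using link[OF N N] by blast
        moreover have "\<Inter>\<F> \<subseteq> topspace X" using N unfolding \<N>_def by blast
        ultimately show ?thesis by blast
      qed
      have cl: "\<And>N. N \<in> \<N> \<Longrightarrow> closedin X N" using \<N>sub Aclopen by metis
      have e: "topspace X \<inter> \<Inter>\<N> \<subseteq> {}" using U(2) unfolding \<N>_def by blast
      show False
        using compact_space_Inter_subset_open[OF comp cl openin_empty e] fin by (metis subset_empty)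
    qed
  qed
  show ?thesis unfolding supercompact_space_def using sub two by blast
qed

lemma zero_dimensional_second_countable_compact_imp_supercompact:
  assumes comp: "compact_space X" and zd: "zero_dimensional_space X" and sc: "second_countable X"
  shows "supercompact_space X"
proof -
  define \<C> where "\<C> = {C. openin X C \<and> closedin X C}"
  have "\<C> \<noteq> {}" unfolding \<C>_def by blast
  then have "\<exists>C :: nat \<Rightarrow> 'a set. range C = \<C>"
    using countable_clopens[OF comp sc] uncountable_def[of \<C>] unfolding \<C>_def[symmetric] by blast
  then obtain C :: "nat \<Rightarrow> 'a set" where C: "range C = \<C>" by blast
  have "openin X (C n) \<and> closedin X (C n)" for n using C \<C>_def by blast
  moreover have "\<exists>n. x \<in> C n \<and> C n \<subseteq> U" if U: "openin X U" "x \<in> U" for U x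
  proof -
    obtain V where "V \<in> \<C>" "x \<in> V" "V \<subseteq> U"
      using zd U unfolding zero_dimensional_space_def \<C>_def by blast
    then show ?thesis using C by blast
  qed
  ultimately show ?thesis using supercompact_space_of_countable_clopens[OF comp, of C] by blast
qed

lemma compact_metrizable_zero_dimensional_imp_hereditarily_supercompact:
  assumes comp: "compact_space X" and met: "metrizable_space X" and zd: "zero_dimensional_space X"
  shows "hereditarily_supercompact_space X"
  unfolding hereditarily_supercompact_space_def
proof (intro allI impI)
  fix S assume "closedin X S"
  then have "compact_space (subtopology X S)"
    using comp closedin_compact_space compact_space_subtopology by blast
  then show "supercompact_space (subtopology X S)"
    by (intro zero_dimensional_second_countable_compact_imp_supercompact zero_dimensional_subtopology zd
        second_countable_subtopology compact_metrizable_imp_second_countable comp met)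
qed

section \<open>Metrizability of countable compact spaces\<close>

text \<open>There are only countably many pairs of distinct points. One separating clopen set per
  pair gives a continuous injection into a countable power of the two-point space, and compactness
  makes it an embedding.\<close>

lemma countable_compact_zero_dimensional_imp_metrizable:
  assumes comp: "compact_space X" and zd: "zero_dimensional_space X" and haus: "Hausdorff_space X"
    and cnt: "countable (topspace X)"
  shows "metrizable_space X"
proof -
  define D where "D = {(x, y). x \<in> topspace X \<and> y \<in> topspace X \<and> x \<noteq> y}"
  have "D \<subseteq> topspace X \<times> topspace X" unfolding D_def by blast
  then have cD: "countable D" using cnt by (meson countable_SIGMA countable_subset)
  have "\<exists>V. openin X V \<and> closedin X V \<and> fst p \<in> V \<and> snd p \<notin> V" if "p \<in> D" for p
  proof -
    have p: "fst p \<in> topspace X" "snd p \<in> topspace X" "fst p \<noteq> snd p" using that by (auto simp: D_def)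
    then have "openin X (topspace X - {snd p})" "fst p \<in> topspace X - {snd p}"
      using haus by (auto intro!: openin_diff closedin_Hausdorff_singleton)
    then show ?thesis using zd unfolding zero_dimensional_space_def by blast
  qed
  then obtain V where V: "\<And>p. p \<in> D \<Longrightarrow> openin X (V p) \<and> closedin X (V p) \<and> fst p \<in> V p \<and> snd p \<notin> V p"
    by metis
  define Z where "Z = product_topology (\<lambda>p. discrete_topology (UNIV :: bool set)) D"
  define f where "f x = (\<lambda>p\<in>D. x \<in> V p)" for x
  have "continuous_map X (discrete_topology UNIV) (\<lambda>x. x \<in> V p)" if p: "p \<in> D" for p
    unfolding continuous_map_def
  proof (intro conjI allI impI)
    fix U :: "bool set"
    have "{x \<in> topspace X. (x \<in> V p) \<in> U} =
      (if True \<in> U then V p else {}) \<union> (if False \<in> U then topspace X - V p else {})"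
      using V[OF p] openin_subset[of X "V p"]
      by (intro set_eqI, rename_tac x, case_tac "x \<in> V p") auto
    then show "openin X {x \<in> topspace X. (x \<in> V p) \<in> U}"
      using V[OF p] by (auto intro: openin_Un)
  qed auto
  then have cont: "continuous_map X Z f"
    unfolding Z_def continuous_map_componentwise f_def by (auto simp: image_subset_iff)
  have inj: "inj_on f (topspace X)"
  proof (rule inj_onI, rule ccontr)
    fix x y assume xy: "x \<in> topspace X" "y \<in> topspace X" "f x = f y" "x \<noteq> y"
    then have "(x, y) \<in> D" by (auto simp: D_def)
    then show False using V[of "(x,y)"] xy(3) unfolding f_def
      by (auto dest: fun_cong[of _ _ "(x, y)"])
  qed
  have "metrizable_space Z" unfolding Z_def metrizable_space_product_topology
    using countable_subset[OF _ cD, of "{i \<in> D. \<not> (\<exists>a. topspace (discrete_topology (UNIV :: bool set)) \<subseteq> {a})}"]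
    by simp
  moreover have "Hausdorff_space Z" unfolding Z_def Hausdorff_space_product_topology by simp
  ultimately have "embedding_map X Z f"
    using continuous_imp_closed_map[OF cont comp] inj cont
    by (simp add: injective_closed_imp_embedding_map)
  then have "X homeomorphic_space subtopology Z (f ` topspace X)"
    using embedding_map_imp_homeomorphic_space by blast
  then show ?thesis
    using \<open>metrizable_space Z\<close> homeomorphic_metrizable_space metrizable_space_subtopology by blast
qed

section \<open>Remainders in supercompact spaces\<close>

text \<open>Dually, in a non-empty space, complements of members of \<open>\<B>\<close> that are
  non-empty and meet pairwise have a common point. It is this Helly-type form that the gate
  construction exploits.\<close>

locale binary_subbase =
  fixes X :: "'a topology" and \<B> :: "'a set set"
  assumes subbase: "subbase_of \<B> X"
    and two_cover: "\<And>\<U>. \<U> \<subseteq> \<B> \<Longrightarrow> \<Union>\<U> = topspace X \<Longrightarrow>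
           \<exists>\<V>\<subseteq>\<U>. finite \<V> \<and> card \<V> \<le> 2 \<and> \<Union>\<V> = topspace X"
begin

text \<open>The intersection of all subbasic closed sets (complements of members of \<open>\<B>\<close>) that
  contain both \<open>a\<close> and \<open>b\<close>.\<close>

definition interval :: "'a \<Rightarrow> 'a \<Rightarrow> 'a set" where
  "interval a b = {y \<in> topspace X. \<forall>U\<in>\<B>. y \<in> U \<longrightarrow> a \<in> U \<or> b \<in> U}"

lemma openin_subbase: "U \<in> \<B> \<Longrightarrow> openin X U"
proof -
  assume U: "U \<in> \<B>"
  then have "U \<subseteq> topspace X" using subbase unfolding subbase_of_def by blast
  then have "(finite intersection_of (\<lambda>U. U \<in> \<B>) relative_to topspace X) U"
    using U finite_intersection_of_inc[of "\<lambda>U. U \<in> \<B>" U] unfolding relative_to_def by blast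
  then show ?thesis
    using subbase arbitrary_union_of_inc unfolding subbase_of_def by metis
qed

lemma closedin_interval: "closedin X (interval a b)"
proof -
  have "interval a b = \<Inter>(insert (topspace X) ((\<lambda>U. topspace X - U) ` {U \<in> \<B>. a \<notin> U \<and> b \<notin> U}))"
    unfolding interval_def by blast
  also have "closedin X \<dots>"
    by (rule closedin_Inter) (auto intro: openin_subbase)
  finally show ?thesis .
qed

lemma interval_right: "b \<in> topspace X \<Longrightarrow> b \<in> interval a b"
  by (simp add: interval_def)

lemma interval_mono: "c \<in> interval a b \<Longrightarrow> interval a c \<subseteq> interval a b"
  unfolding interval_def by blast

lemma gate:
  assumes F: "F \<subseteq> \<B>" and T: "T = {y \<in> topspace X. \<forall>U\<in>F. y \<notin> U}" "T \<noteq> {}" and a: "a \<in> topspace X"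
  shows "\<exists>g\<in>T. \<forall>t\<in>T. g \<in> interval a t"
proof -
  \<comment> \<open>The closed sets containing \<open>T\<close> together with those containing \<open>a\<close> and a point of \<open>T\<close>
    meet pairwise, hence have a common point.\<close>
  define \<U> where "\<U> = {U\<in>\<B>. T \<inter> U = {} \<or> (\<exists>t\<in>T. a \<notin> U \<and> t \<notin> U)}"
  \<comment> \<open>Two complements containing \<open>T\<close> share all of \<open>T\<close>, two
    containing \<open>a\<close> share \<open>a\<close>, and in the mixed case the point
    \<open>t\<close> is shared.\<close>
  have miss: "\<exists>y\<in>topspace X. y \<notin> U \<and> y \<notin> V" if "U \<in> \<U>" "V \<in> \<U>" for U V
    using that T a unfolding \<U>_def by blast
  have "\<Union>\<U> \<noteq> topspace X"
  proof
    assume "\<Union>\<U> = topspace X"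
    then obtain \<V> where V: "\<V> \<subseteq> \<U>" "finite \<V>" "card \<V> \<le> 2" "\<Union>\<V> = topspace X"
      using two_cover[of \<U>] unfolding \<U>_def by blast
    then have "card \<V> = 0 \<or> card \<V> = 1 \<or> card \<V> = 2" by linarith
    then consider "\<V> = {}" | U where "\<V> = {U}" | U U' where "\<V> = {U, U'}"
      using V(2) card_1_singletonE[of \<V>] card_2_iff[of \<V>] card_0_eq[of \<V>] by metis
    then show False
    proof cases
      case 1 then show ?thesis using V(4) a by simp
    next
      case 2 then show ?thesis using V miss[of U U] by blast
    next
      case 3 then show ?thesis using V miss[of U U'] by blast
    qed
  qed
  moreover have "\<Union>\<U> \<subseteq> topspace X" using openin_subbase[THEN openin_subset] unfolding \<U>_def by blast
  ultimately obtain g where g: "g \<in> topspace X" "\<And>U. U \<in> \<U> \<Longrightarrow> g \<notin> U" by blast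
  have "g \<in> T" using g F unfolding T(1) \<U>_def by blast
  moreover have "g \<in> interval a t" if "t \<in> T" for t
    using that g unfolding interval_def \<U>_def by blast
  ultimately show ?thesis by blast
qed

text \<open>By compactness \<open>K\<close> is a finite union of finite intersections of subbasic
  sets. Collecting all of these in \<open>F\<close>, membership in \<open>K\<close> is inherited by
  every point that lies in at least the same members of \<open>F\<close>.\<close>

lemma clopen_finite_subbase:
  assumes comp: "compact_space X" and K: "openin X K" "closedin X K"
  shows "\<exists>F. finite F \<and> F \<subseteq> \<B> \<and>
    (\<forall>x\<in>topspace X. \<forall>y\<in>K. (\<forall>U\<in>F. y \<in> U \<longrightarrow> x \<in> U) \<longrightarrow> x \<in> K)"
proof -
  have base: "\<exists>F. finite F \<and> F \<subseteq> \<B> \<and> y \<in> topspace X \<inter> \<Inter>F \<and> topspace X \<inter> \<Inter>F \<subseteq> K" if y: "y \<in> K" for y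
  proof -
    have "(arbitrary union_of (finite intersection_of (\<lambda>U. U \<in> \<B>) relative_to topspace X)) K"
      using subbase K(1) unfolding subbase_of_def by metis
    then obtain V where "(finite intersection_of (\<lambda>U. U \<in> \<B>) relative_to topspace X) V" "y \<in> V" "V \<subseteq> K"
      using y unfolding arbitrary_union_of_alt by blast
    then show ?thesis unfolding relative_to_def intersection_of_def by auto
  qed
  have "compactin X K" using comp K closedin_compact_space by blast
  define \<O> where "\<O> = {topspace X \<inter> \<Inter>F | F. finite F \<and> F \<subseteq> \<B> \<and> topspace X \<inter> \<Inter>F \<subseteq> K}"
  have op: "openin X V" if "V \<in> \<O>" for V
  proof -
    obtain F where F: "finite F" "F \<subseteq> \<B>" "V = topspace X \<inter> \<Inter>F" using \<open>V \<in> \<O>\<close> unfolding \<O>_def by blast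
    have "V = \<Inter>(insert (topspace X) F)" using F by simp
    also have "openin X \<dots>"
      by (rule openin_Inter) (use F openin_subbase in auto)
    finally show ?thesis .
  qed
  have cover: "K \<subseteq> \<Union>\<O>"
  proof
    fix y assume "y \<in> K"
    then obtain F where "finite F" "F \<subseteq> \<B>" "y \<in> topspace X \<inter> \<Inter>F" "topspace X \<inter> \<Inter>F \<subseteq> K"
      using base[OF \<open>y \<in> K\<close>] by (elim exE conjE)
    then have "topspace X \<inter> \<Inter>F \<in> \<O>" unfolding \<O>_def mem_Collect_eq by (intro exI[of _ F] conjI refl)
    then show "y \<in> \<Union>\<O>" using \<open>y \<in> topspace X \<inter> \<Inter>F\<close> by (rule UnionI)
  qed
  obtain \<G> where \<G>: "finite \<G>" "\<G> \<subseteq> \<O>" "K \<subseteq> \<Union>\<G>"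
    using compactinD[OF \<open>compactin X K\<close> op cover] by blast
  have "\<exists>F. finite F \<and> F \<subseteq> \<B> \<and> V \<subseteq> \<Inter>F \<and> topspace X \<inter> \<Inter>F \<subseteq> K" if V: "V \<in> \<G>" for V
  proof -
    obtain F where "V = topspace X \<inter> \<Inter>F" "finite F" "F \<subseteq> \<B>" "topspace X \<inter> \<Inter>F \<subseteq> K"
      using V \<G>(2) unfolding \<O>_def by auto
    then show ?thesis by (intro exI[of _ F]) simp
  qed
  then obtain f where f: "\<And>V. V \<in> \<G> \<Longrightarrow> finite (f V) \<and> f V \<subseteq> \<B> \<and> V \<subseteq> \<Inter>(f V) \<and> topspace X \<inter> \<Inter>(f V) \<subseteq> K"
    by metis
  have "x \<in> K" if x: "x \<in> topspace X" "y \<in> K" "\<forall>U\<in>\<Union>(f ` \<G>). y \<in> U \<longrightarrow> x \<in> U" for x y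
  proof -
    obtain V where V: "V \<in> \<G>" "y \<in> V" using \<G>(3) x(2) by blast
    then have "y \<in> \<Inter>(f V)" using f by blast
    then have "x \<in> topspace X \<inter> \<Inter>(f V)" using x V(1) by blast
    then show ?thesis using f[OF V(1)] by blast
  qed
  moreover have "finite (\<Union>(f ` \<G>))" "\<Union>(f ` \<G>) \<subseteq> \<B>" using \<G>(1) f by (simp, metis UN_least f)
  ultimately show ?thesis by blast
qed

text \<open>The relation \<open>y \<in> interval a x\<close> is transitive but need not be
  antisymmetric, so Zorn's lemma is applied to the sets \<open>interval a x \<inter> R\<close>
  instead of to points. Complements turn the minimal set into a maximal one, and compactness puts a
  point into the intersection of a chain.\<close>

lemma minimal_interval:
  assumes comp: "compact_space X" and R: "closedin X R" and Q: "Q \<subseteq> R" "Q \<noteq> {}"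
    and down: "\<And>x y. x \<in> Q \<Longrightarrow> y \<in> R \<Longrightarrow> y \<in> interval a x \<Longrightarrow> y \<in> Q"
  shows "\<exists>x\<in>Q. \<forall>y\<in>R. y \<in> interval a x \<longrightarrow> x \<in> interval a y"
proof -
  define \<A> where "\<A> = (\<lambda>x. topspace X - interval a x \<inter> R) ` Q"
  have RX: "R \<subseteq> topspace X" using R closedin_subset by blast
  have "\<exists>M\<in>\<A>. \<forall>A\<in>\<A>. M \<subseteq> A \<longrightarrow> A = M"
  proof (rule subset_Zorn)
    fix \<C> assume ch: "subset.chain \<A> \<C>"
    show "\<exists>U\<in>\<A>. \<forall>A\<in>\<C>. A \<subseteq> U"
    proof (cases "\<C> = {}")
      case True
      then show ?thesis using Q unfolding \<A>_def by blast
    next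
      case False
      define \<D> where "\<D> = (\<lambda>A. topspace X - A) ` \<C>"
      have \<D>: "\<exists>x\<in>Q. D = interval a x \<inter> R" if D: "D \<in> \<D>" for D
      proof -
        obtain A where A: "A \<in> \<C>" "D = topspace X - A" using D unfolding \<D>_def by blast
        then obtain x where "x \<in> Q" "A = topspace X - interval a x \<inter> R"
          using ch unfolding subset_chain_def \<A>_def by blast
        then show ?thesis using A RX by blast
      qed
      have cl: "closedin X D" if "D \<in> \<D>" for D
        using \<D>[OF that] closedin_interval R by auto
      have "\<Inter>\<D> \<noteq> {}"
      proof
        assume e: "\<Inter>\<D> = {}"
        then obtain \<F> where \<F>: "finite \<F>" "\<F> \<subseteq> \<D>" "topspace X \<inter> \<Inter>\<F> \<subseteq> {}"
          using compact_space_Inter_subset_open[OF comp cl openin_empty, of \<D>] by auto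
        have "topspace X \<noteq> {}" using Q RX by blast
        then have "\<F> \<noteq> {}" using \<F>(3) by auto
        have "\<Inter>\<F> \<in> \<F>" using \<F>(1) \<open>\<F> \<noteq> {}\<close> \<F>(2)
        proof (induction \<F> rule: finite_ne_induct)
          case (insert D \<F>)
          then have I: "\<Inter>\<F> \<in> \<F>" by simp
          then have "D \<in> \<D>" "\<Inter>\<F> \<in> \<D>" using insert by auto
          then obtain A B where "A \<in> \<C>" "B \<in> \<C>" "D = topspace X - A" "\<Inter>\<F> = topspace X - B"
            unfolding \<D>_def by blast
          moreover have "A \<subseteq> B \<or> B \<subseteq> A" using ch calculation unfolding subset_chain_def by blast
          ultimately have "D \<subseteq> \<Inter>\<F> \<or> \<Inter>\<F> \<subseteq> D" by (metis Diff_mono order_refl)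
          then show ?case using I by (auto simp: Int_absorb1 Int_absorb2)
        qed auto
        then obtain x where x: "x \<in> Q" "\<Inter>\<F> = interval a x \<inter> R" using \<D> \<F>(2) by blast
        then have "x \<in> topspace X \<inter> \<Inter>\<F>" using interval_right[of x a] Q RX by blast
        then show False using \<F>(3) by blast
      qed
      then obtain y where y: "\<And>D. D \<in> \<D> \<Longrightarrow> y \<in> D" by blast
      obtain A0 where A0: "A0 \<in> \<C>" using False by blast
      then obtain x0 where "x0 \<in> Q" "topspace X - A0 = interval a x0 \<inter> R" "y \<in> topspace X - A0"
        using \<D> y unfolding \<D>_def by blast
      then have yQ: "y \<in> Q" using down by blast
      have "A \<subseteq> topspace X - interval a y \<inter> R" if A: "A \<in> \<C>" for A
      proof -
        obtain x where x: "x \<in> Q" "topspace X - A = interval a x \<inter> R" "y \<in> topspace X - A"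
          using A \<D> y unfolding \<D>_def by blast
        then have "interval a y \<subseteq> interval a x" using interval_mono by blast
        moreover have "A \<subseteq> topspace X" using ch A unfolding subset_chain_def \<A>_def by blast
        ultimately show ?thesis using x by blast
      qed
      then show ?thesis using yQ unfolding \<A>_def by blast
    qed
  qed
  then obtain x where x: "x \<in> Q"
    and max: "\<And>y. y \<in> Q \<Longrightarrow> topspace X - interval a x \<inter> R \<subseteq> topspace X - interval a y \<inter> R \<Longrightarrow>
      topspace X - interval a y \<inter> R = topspace X - interval a x \<inter> R"
    unfolding \<A>_def by blast
  have "x \<in> interval a y" if y: "y \<in> R" "y \<in> interval a x" for y
  proof -
    have "topspace X - interval a y \<inter> R = topspace X - interval a x \<inter> R"
      using interval_mono[OF y(2)] by (intro max down[OF x y]) blast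
    moreover have "x \<in> interval a x \<inter> R" using x Q RX interval_right by blast
    ultimately show ?thesis using RX by blast
  qed
  then show ?thesis using x by blast
qed

end

section \<open>Separability of the remainder\<close>

text \<open>A hands-on substitute for a countable elementary submodel. It is reached after countably
  many steps because a finite subset of the union already lies in one stage.\<close>

lemma countable_closure_under_finite_sets:
  assumes W: "countable W" and I: "countable I"
  shows "\<exists>M. countable M \<and> W \<subseteq> M \<and> (\<forall>i\<in>I. \<forall>F. finite F \<and> F \<subseteq> M \<longrightarrow> f i F \<in> M)"
proof -
  define step where "step S = S \<union> (\<lambda>(i, F). f i F) ` (I \<times> {F. finite F \<and> F \<subseteq> S})" for S
  define Mn where "Mn n = (step ^^ n) W" for n
  have Suc: "Mn (Suc n) = step (Mn n)" for n by (simp add: Mn_def)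
  have cnt: "countable (Mn n)" for n
  proof (induction n)
    case 0 then show ?case using W by (simp add: Mn_def)
  next
    case (Suc n)
    then show ?case unfolding \<open>\<And>n. Mn (Suc n) = step (Mn n)\<close> step_def
      by (intro countable_Un countable_image countable_SIGMA I countable_Collect_finite_subset)
  qed
  have mono: "Mn m \<subseteq> Mn n" if "m \<le> n" for m n
    using that by (rule lift_Suc_mono_le[rotated]) (auto simp: Suc step_def)
  define M where "M = (\<Union>n. Mn n)"
  have fin: "\<exists>n. F \<subseteq> Mn n" if "finite F" "F \<subseteq> M" for F
    using that
  proof (induction F)
    case (insert x F)
    then obtain m n where "F \<subseteq> Mn n" "x \<in> Mn m" unfolding M_def by auto
    then have "insert x F \<subseteq> Mn (max m n)" using mono[of m "max m n"] mono[of n "max m n"] by auto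
    then show ?case by blast
  qed simp
  have "f i F \<in> M" if iF: "i \<in> I" "finite F" "F \<subseteq> M" for i F
  proof -
    obtain n where "F \<subseteq> Mn n" using fin iF by blast
    then have "f i F \<in> Mn (Suc n)" using iF unfolding Suc step_def by force
    then show ?thesis unfolding M_def by blast
  qed
  moreover have "W = Mn 0" by (simp add: Mn_def)
  then have "W \<subseteq> M" unfolding M_def by blast
  moreover have "countable M" unfolding M_def using cnt by simp
  ultimately show ?thesis by blast
qed

text \<open>Bell's theorem on remainders of supercompact compactifications.  The dense set is the trace on
  \<open>R\<close> of a countable set \<open>M \<supseteq> X - R\<close> closed under choosing points of \<open>R\<close> that are minimal,
  as seen from some \<open>a\<close>, while keeping the interval from \<open>a\<close> disjoint from a given finite
  subset of \<open>M\<close>.  If a clopen \<open>P\<close> met \<open>R\<close> but not \<open>M \<inter> R\<close>, then finitely many points of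
  \<open>M - P\<close> would suffice to block every interval from \<open>a \<in> P\<close> to the complement of \<open>P\<close>, and closure
  of \<open>M\<close> would yield a point of \<open>M \<inter> R\<close> inside \<open>P\<close> after all.\<close>

lemma (in binary_subbase) separable_remainder:
  assumes comp: "compact_space X" and zd: "zero_dimensional_space X" and R: "closedin X R"
    and cnt: "countable (topspace X - R)" and dense: "X closure_of (topspace X - R) = topspace X"
  shows "\<exists>Q. countable Q \<and> Q \<subseteq> R \<and> (\<forall>V. openin X V \<and> V \<inter> R \<noteq> {} \<longrightarrow> V \<inter> Q \<noteq> {})"
proof -
  define W where "W = topspace X - R"
  have RX: "R \<subseteq> topspace X" using R closedin_subset by blast
  have meetsW: "V \<inter> W \<noteq> {}" if V: "openin X V" "V \<noteq> {}" for V
    using V dense openin_subset[OF V(1)] unfolding W_def[symmetric] in_closure_of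
    by (metis (no_types, lifting) disjoint_iff ex_in_conv in_closure_of subsetD)
  define Qs where "Qs a G F = {y \<in> R. (\<exists>t\<in>G. y \<in> interval a t) \<and> interval a y \<inter> F = {}}" for a G F
  define minimal where "minimal a x \<longleftrightarrow> (\<forall>y\<in>R. y \<in> interval a x \<longrightarrow> x \<in> interval a y)" for a x
  have min_ex: "\<exists>x. x \<in> Qs a G F \<and> minimal a x" if ne: "Qs a G F \<noteq> {}" for a G F
  proof -
    have "y \<in> Qs a G F" if "x \<in> Qs a G F" "y \<in> R" "y \<in> interval a x" for x y
      using that interval_mono[OF that(3)] interval_mono[of x a] unfolding Qs_def by blast
    moreover have "Qs a G F \<subseteq> R" unfolding Qs_def by blast
    ultimately show ?thesis using minimal_interval[OF comp R _ ne, of a] unfolding minimal_def by blast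
  qed
  \<comment> \<open>The Boolean merges two choice functions into one, so a single closure serves
    both. If no candidate exists the value is arbitrary; this is harmless, as only
    \<open>M \<inter> R\<close> and \<open>M \<inter> K\<close> are used later.\<close>
  define f where "f = (\<lambda>(b, a, G) F. if b then SOME x. x \<in> Qs a G F \<and> minimal a x
    else SOME y. y \<in> R \<and> interval a y \<inter> F = {})"
  obtain M where M: "countable M" "W \<subseteq> M"
    and closed: "\<And>i F. i \<in> UNIV \<times> W \<times> {G. finite G \<and> G \<subseteq> W} \<Longrightarrow> finite F \<Longrightarrow> F \<subseteq> M \<Longrightarrow> f i F \<in> M"
  proof -
    have "countable (UNIV \<times> W \<times> {G. finite G \<and> G \<subseteq> W} :: (bool \<times> 'a \<times> 'a set) set)"
      using cnt unfolding W_def by (intro countable_SIGMA countable_Collect_finite_subset) auto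
    then show thesis
      using countable_closure_under_finite_sets[of W "UNIV \<times> W \<times> {G. finite G \<and> G \<subseteq> W}" f]
        cnt that unfolding W_def[symmetric] by meson
  qed
  have M_min: "\<exists>x\<in>M. x \<in> Qs a G F \<and> minimal a x"
    if "a \<in> W" "finite G" "G \<subseteq> W" "finite F" "F \<subseteq> M" "Qs a G F \<noteq> {}" for a G F
    using closed[of "(True, a, G)" F] someI_ex[OF min_ex[OF that(6)]] that by (auto simp: f_def)
  have M_avoid: "\<exists>z\<in>M. z \<in> R \<and> interval a z \<inter> F = {}"
    if "a \<in> W" "finite F" "F \<subseteq> M" "r \<in> R" "interval a r \<inter> F = {}" for a F r
    using closed[of "(False, a, {})" F] that someI[of "\<lambda>y. y \<in> R \<and> interval a y \<inter> F = {}" r]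
    by (auto simp: f_def)
  have main: "V \<inter> (M \<inter> R) \<noteq> {}" if V: "openin X V" "V \<inter> R \<noteq> {}" for V
  proof
    assume emp: "V \<inter> (M \<inter> R) = {}"
    obtain r where r: "r \<in> V" "r \<in> R" using V by blast
    obtain P where P: "openin X P" "closedin X P" "r \<in> P" "P \<subseteq> V"
      using zd V(1) r(1) unfolding zero_dimensional_space_def by blast
    have PX: "P \<subseteq> topspace X" using P(1) openin_subset by blast
    define K where "K = topspace X - P"
    have K: "openin X K" "closedin X K" using P unfolding K_def by auto
    obtain F1 where F1: "finite F1" "F1 \<subseteq> \<B>"
      "\<And>x y. x \<in> topspace X \<Longrightarrow> y \<in> P \<Longrightarrow> (\<forall>U\<in>F1. y \<in> U \<longrightarrow> x \<in> U) \<Longrightarrow> x \<in> P"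
      using clopen_finite_subbase[OF comp P(1,2)] by blast
    obtain F2 where F2: "finite F2" "F2 \<subseteq> \<B>"
      "\<And>x y. x \<in> topspace X \<Longrightarrow> y \<in> K \<Longrightarrow> (\<forall>U\<in>F2. y \<in> U \<longrightarrow> x \<in> U) \<Longrightarrow> x \<in> K"
      using clopen_finite_subbase[OF comp K] by blast
    \<comment> \<open>With both families in \<open>B\<close>, each class \<open>H x\<close> stays on
      the side of \<open>P\<close> or \<open>K\<close> to which \<open>x\<close> belongs. It is also
      an intersection of subbasic closed sets, so it has gates.\<close>
    define B where "B = F1 \<union> F2"
    have B: "finite B" "B \<subseteq> \<B>" using F1 F2 unfolding B_def by auto
    define H where "H x = {y \<in> topspace X. \<forall>U\<in>B. y \<in> U \<longrightarrow> x \<in> U}" for x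
    have HP: "H x \<subseteq> P" if "x \<in> P" for x
      using that F2(3)[of x] PX unfolding H_def B_def K_def by blast
    have HK: "H x \<subseteq> K" if "x \<in> K" for x
      using that F1(3)[of x] PX unfolding H_def B_def K_def by blast
    have Hrefl: "x \<in> H x" if "x \<in> topspace X" for x using that unfolding H_def by blast
    have Hclosed: "closedin X (H x)" for x
    proof -
      have "H x = topspace X - \<Union>{U \<in> B. x \<notin> U}" unfolding H_def by blast
      also have "closedin X \<dots>"
        using B openin_subbase by (intro closedin_diff closedin_topspace openin_Union) blast
      finally show ?thesis .
    qed
    have Hfin: "finite (range H)"
    proof (rule finite_subset)
      show "range H \<subseteq> (\<lambda>C. {y \<in> topspace X. \<forall>U\<in>B. y \<in> U \<longrightarrow> U \<in> C}) ` Pow B"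
      proof (rule image_subsetI)
        fix x
        have "H x = {y \<in> topspace X. \<forall>U\<in>B. y \<in> U \<longrightarrow> U \<in> {U\<in>B. x \<in> U}}" unfolding H_def by blast
        then show "H x \<in> (\<lambda>C. {y \<in> topspace X. \<forall>U\<in>B. y \<in> U \<longrightarrow> U \<in> C}) ` Pow B"
          by (rule image_eqI[where x = "{U\<in>B. x \<in> U}"]) blast
      qed
      show "finite ((\<lambda>C. {y \<in> topspace X. \<forall>U\<in>B. y \<in> U \<longrightarrow> U \<in> C}) ` Pow B)" using B by simp
    qed
    \<comment> \<open>There are finitely many classes and they are closed. What those of points in
      \<open>N \<inter> W\<close> leave uncovered in \<open>N\<close> is open and misses the dense
      set \<open>W\<close>, hence is empty.\<close>
    have cover: "\<exists>G. finite G \<and> G \<subseteq> N \<inter> W \<and> N \<subseteq> \<Union>(H ` G)" if N: "openin X N" for N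
    proof -
      have "finite (H ` (N \<inter> W))" using Hfin by (rule finite_subset[rotated]) blast
      then obtain G where G: "G \<subseteq> N \<inter> W" "finite G" "H ` (N \<inter> W) = H ` G"
        using finite_subset_image[of "H ` (N \<inter> W)" H "N \<inter> W"] by blast
      have "closedin X (\<Union>(H ` G))" using G Hclosed by (intro closedin_Union) auto
      then have "openin X (N - \<Union>(H ` G))" using N by blast
      moreover have "(N - \<Union>(H ` G)) \<inter> W = {}"
        using G(3) Hrefl unfolding W_def by blast
      ultimately have "N - \<Union>(H ` G) = {}" using meetsW by blast
      then show ?thesis using G by blast
    qed
    obtain a where a: "a \<in> P" "a \<in> W" "r \<in> H a" using cover[OF P(1)] P(3) by blast
    have aX: "a \<in> topspace X" using a unfolding W_def by blast
    obtain G where G: "finite G" "G \<subseteq> K \<inter> W" "K \<subseteq> \<Union>(H ` G)" using cover[OF K(1)] by blast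
    have "\<exists>g\<in>H t. \<forall>u\<in>H t. g \<in> interval a u" if t: "t \<in> G" for t
    proof (rule gate[where F = "{U\<in>B. t \<notin> U}"])
      show "H t = {y \<in> topspace X. \<forall>U\<in>{U\<in>B. t \<notin> U}. y \<notin> U}" unfolding H_def by blast
      show "H t \<noteq> {}" using Hrefl[of t] t G unfolding W_def by blast
    qed (use B aX in auto)
    then obtain g where g: "\<And>t. t \<in> G \<Longrightarrow> g t \<in> H t" "\<And>t u. t \<in> G \<Longrightarrow> u \<in> H t \<Longrightarrow> g t \<in> interval a u"
      by metis
    have gK: "g t \<in> K" if "t \<in> G" for t using g(1)[OF that] HK[of t] G that by blast
    have gX: "g t \<in> topspace X" if "t \<in> G" for t using gK[OF that] unfolding K_def by blast
    \<comment> \<open>Each new point \<open>x\<close> is equivalent, as seen from \<open>a\<close>, to a gate that was not yet blocked; so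
      at most \<open>card G\<close> steps are needed.\<close>
    have saturate: "\<exists>F'. finite F' \<and> F' \<subseteq> M \<inter> K \<and> {t\<in>G. interval a (g t) \<inter> F' = {}} = {}"
      if "finite F" "F \<subseteq> M \<inter> K" "g ` G \<inter> W \<subseteq> F" for F
      using that
    proof (induction "card {t\<in>G. interval a (g t) \<inter> F = {}}" arbitrary: F rule: less_induct)
      case less
      define J where "J = (\<lambda>F. {t\<in>G. interval a (g t) \<inter> F = {}})"
      \<comment> \<open>A gate in \<open>W\<close> belongs to \<open>F\<close> from the start and
        lies in its own interval, so it counts as blocked.\<close>
      have gR: "g t \<in> R" if "t \<in> J F" for t
        using that less.prems(3) gX[of t] interval_right[of "g t" a] unfolding J_def W_def by blast
      show ?case
      proof (cases "J F = {}")
        case True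
        then show ?thesis using less.prems unfolding J_def by blast
      next
        case False
        then obtain t0 where t0: "t0 \<in> J F" by blast
        then have "t0 \<in> G" unfolding J_def by blast
        then have "g t0 \<in> interval a t0" using g(2)[of t0 t0] Hrefl[of t0] G unfolding W_def by blast
        then have "g t0 \<in> Qs a G F" using t0 gR[OF t0] \<open>t0 \<in> G\<close> unfolding Qs_def J_def by blast
        then obtain x where x: "x \<in> M" "x \<in> Qs a G F" "minimal a x"
          using M_min[of a G F] a(2) G less.prems by blast
        have xR: "x \<in> R" "interval a x \<inter> F = {}" using x(2) unfolding Qs_def by auto
        \<comment> \<open>Here the assumption that \<open>V\<close> misses
          \<open>M \<inter> R\<close> enters: it keeps the new point out of \<open>P\<close>, so
          \<open>x\<close> lies in some class \<open>H t\<close> and \<open>F\<close> may grow by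
          \<open>x\<close> inside \<open>K\<close>.\<close>
        have xK: "x \<in> K" using xR x(1) emp P(4) RX unfolding K_def by blast
        obtain t where t: "t \<in> G" "x \<in> H t" using xK G(3) by blast
        have gx: "g t \<in> interval a x" using g(2) t by blast
        then have tJ: "t \<in> J F" using interval_mono[OF gx] xR(2) t(1) unfolding J_def by blast
        then have "x \<in> interval a (g t)" using x(3) gR gx unfolding minimal_def by blast
        then have "J (insert x F) \<subset> J F" using tJ unfolding J_def by blast
        moreover have "finite (J F)" using G unfolding J_def by simp
        ultimately have "card (J (insert x F)) < card (J F)" by (simp add: psubset_card_mono)
        then show ?thesis
          unfolding J_def by (rule less.hyps) (use less.prems x(1) xK in auto)
      qed
    qed
    have "finite (g ` G \<inter> W)" "g ` G \<inter> W \<subseteq> M \<inter> K" using G(1) M(2) gK by (blast intro: finite_Int finite_imageI)+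
    from saturate[OF this order_refl] obtain F where F: "finite F" "F \<subseteq> M \<inter> K" "{t\<in>G. interval a (g t) \<inter> F = {}} = {}"
      by blast
    have FK: "interval a y \<inter> F \<noteq> {}" if y: "y \<in> K" for y
    proof -
      obtain t where t: "t \<in> G" "y \<in> H t" using y G(3) by blast
      then have "interval a (g t) \<subseteq> interval a y" using g(2) interval_mono by blast
      then show ?thesis using F(3) t(1) by blast
    qed
    \<comment> \<open>Since \<open>r \<in> H a\<close>, every subbasic set of \<open>B\<close> that
      contains \<open>r\<close> contains \<open>a\<close>. So the interval stays in \<open>P\<close>
      and avoids \<open>F\<close>; a point of \<open>M \<inter> R\<close> then does the same, and
      \<open>FK\<close> forces it into \<open>P\<close>.\<close>
    have "interval a r \<subseteq> H a" using a(3) B(2) unfolding interval_def H_def by blast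
    then have "interval a r \<inter> F = {}" using HP[OF a(1)] F(2) unfolding K_def by blast
    then obtain z where z: "z \<in> M" "z \<in> R" "interval a z \<inter> F = {}"
      using M_avoid[of a F r] a(2) F r(2) by blast
    then have "z \<notin> K" using FK by blast
    then show False using z emp P(4) RX unfolding K_def by blast
  qed
  show ?thesis using main M(1) by (intro exI[of _ "M \<inter> R"]) auto
qed

lemma supercompact_separable_remainder:
  assumes "supercompact_space X" "compact_space X" "zero_dimensional_space X" "closedin X R"
    and "countable (topspace X - R)" "X closure_of (topspace X - R) = topspace X"
  shows "\<exists>Q. countable Q \<and> Q \<subseteq> R \<and> (\<forall>V. openin X V \<and> V \<inter> R \<noteq> {} \<longrightarrow> V \<inter> Q \<noteq> {})"
proof -
  obtain \<B> where "subbase_of \<B> X"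
    "\<forall>\<U>\<subseteq>\<B>. \<Union>\<U> = topspace X \<longrightarrow> (\<exists>\<V>\<subseteq>\<U>. finite \<V> \<and> card \<V> \<le> 2 \<and> \<Union>\<V> = topspace X)"
    using assms(1) unfolding supercompact_space_def by blast
  then interpret binary_subbase X \<B> by unfold_locales blast+
  show ?thesis using separable_remainder assms by blast
qed

section \<open>Discrete subsets under Martin's Axiom\<close>

text \<open>A counterexample \<open>A\<close> to CH is uncountable and smaller than the continuum.
  Comparing cardinals, either \<open>A\<close> embeds into \<open>S\<close> or \<open>S\<close> is
  already small enough.\<close>

lemma uncountable_subset_lesspoll_real:
  assumes "\<not> continuum_hypothesis" and S: "uncountable S"
  shows "\<exists>D\<subseteq>S. uncountable D \<and> D \<prec> (UNIV :: real set)"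
proof -
  include cardinal_syntax
  obtain A :: "real set" where A: "uncountable A" "\<not> A \<approx> (UNIV :: real set)"
    using assms(1) unfolding continuum_hypothesis_def by blast
  have AR: "A \<prec> (UNIV :: real set)"
    using A(2) subset_imp_lepoll[of A UNIV] lepoll_iff_leqpoll by blast
  have "|A| \<le>o |S| \<or> |S| \<le>o |A|" by (rule ordLeq_total[OF card_of_Well_order card_of_Well_order])
  then have "A \<lesssim> S \<or> S \<lesssim> A" unfolding lepoll_def card_of_ordLeq .
  then show ?thesis
  proof
    assume "A \<lesssim> S"
    then obtain f where f: "inj_on f A" "f ` A \<subseteq> S" unfolding lepoll_def by blast
    have "uncountable (f ` A)" using A(1) countable_image_inj_on[OF _ f(1)] by blast
    moreover have "f ` A \<prec> (UNIV :: real set)" using image_lepoll AR by (rule lesspoll_trans1)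
    ultimately show ?thesis using f(2) by blast
  next
    assume "S \<lesssim> A"
    then have "S \<prec> (UNIV :: real set)" using AR by (rule lesspoll_trans1)
    then show ?thesis using S by blast
  qed
qed

lemma infinite_times_countable_lepoll:
  assumes D: "infinite D" and J: "countable J"
  shows "D \<times> J \<lesssim> D"
proof -
  have "J \<lesssim> (UNIV :: nat set)" using J unfolding countable_def lepoll_def by blast
  also have "(UNIV :: nat set) \<lesssim> D" using D infinite_le_lepoll by blast
  finally have "D \<times> J \<lesssim> D \<times> D" by (intro times_lepoll_mono) auto
  also have "D \<times> D \<lesssim> D"
    using card_of_Times_same_infinite[OF D] unfolding lepoll_def
    by (metis card_of_ordLeq ordIso_imp_ordLeq)
  finally show ?thesis .
qed

lemma MA_generic_filter:
  assumes MA: "martins_axiom TYPE(real)"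
    and "P \<noteq> {}" "partial_order_on P r" "ccc_order P r"
    and dense: "\<And>i. i \<in> I \<Longrightarrow> dense_in_order P r (E i)" and I: "I \<prec> (UNIV :: real set)"
  shows "\<exists>G. filter_in_order P r G \<and> (\<forall>i\<in>I. G \<inter> E i \<noteq> {})"
proof -
  have "E ` I \<prec> (UNIV :: real set)" using image_lepoll I by (rule lesspoll_trans1)
  moreover have "\<forall>D\<in>E ` I. dense_in_order P r D" using dense by simp
  ultimately have "\<exists>G. filter_in_order P r G \<and> (\<forall>D\<in>E ` I. G \<inter> D \<noteq> {})"
    using assms(2-4)
    by (intro martins_axiom_real_imp[OF MA, unfolded martins_axiom_def, rule_format] conjI) auto
  then show ?thesis by simp
qed

section \<open>Almost disjoint refinements\<close>

lemma MA_almost_disjoint_refinement: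
  fixes A :: "'d \<Rightarrow> 'a set"
  assumes MA: "martins_axiom TYPE(real)" and I: "countable I"
    and D: "infinite D" "D \<prec> (UNIV :: real set)"
    and inf: "\<And>d F. d \<in> D \<Longrightarrow> finite F \<Longrightarrow> F \<subseteq> D \<Longrightarrow>
      infinite (I \<inter> A d - (\<Union>e\<in>F. \<Union>e'\<in>F - {e}. A e \<inter> A e'))"
  shows "\<exists>C\<subseteq>I. (\<forall>d\<in>D. infinite (C \<inter> A d)) \<and> (\<forall>d\<in>D. \<forall>e\<in>D. d \<noteq> e \<longrightarrow> finite (C \<inter> A d \<inter> A e))"
proof -
  \<comment> \<open>A condition \<open>(s, F)\<close> puts \<open>s\<close> into \<open>C\<close> and forbids adding further points that lie in two
    of the sets \<open>A e\<close> with \<open>e \<in> F\<close>.\<close>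
  define P where "P = {(s, F). finite s \<and> s \<subseteq> I \<and> finite F \<and> F \<subseteq> D}"
  define ext where "ext = (\<lambda>(s', F') (s, F). s \<subseteq> s' \<and> F \<subseteq> F' \<and>
    (s' - s) \<inter> (\<Union>e\<in>F. \<Union>e'\<in>F - {e}. A e \<inter> A e') = {})"
  define r where "r = {(p, q). p \<in> P \<and> q \<in> P \<and> ext p q}"
  \<comment> \<open>The parameter \<open>s0\<close> forces infinity: were
    \<open>C \<inter> A d\<close> finite, it could be taken as \<open>s0\<close>, and the filter
    would supply a further point of \<open>A d\<close>.\<close>
  define E where "E = (\<lambda>(d, s0). {(s, F) \<in> P. d \<in> F \<and> \<not> s \<inter> A d \<subseteq> s0})"
  define J where "J = D \<times> {s. finite s \<and> s \<subseteq> I}"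
  have ne: "P \<noteq> {}" unfolding P_def by blast
  have po: "partial_order_on P r"
    unfolding partial_order_on_def preorder_on_def
  proof (intro conjI)
    show "refl_on P r" unfolding refl_on_def r_def ext_def by auto
    show "r \<subseteq> P \<times> P" unfolding r_def by auto
    show "trans r"
    proof (rule transI)
      fix p q t assume "(p, q) \<in> r" "(q, t) \<in> r"
      moreover obtain s1 F1 s2 F2 s3 F3 where "p = (s1, F1)" "q = (s2, F2)" "t = (s3, F3)"
        by (metis surj_pair)
      ultimately show "(p, t) \<in> r" unfolding r_def ext_def by auto blast
    qed
    show "antisym r"
      unfolding antisym_def r_def ext_def by auto
  qed
  have ccc: "ccc_order P r"
    unfolding ccc_order_def
  proof (intro allI impI)
    fix Q assume Q: "Q \<subseteq> P" and anti: "\<forall>p\<in>Q. \<forall>q\<in>Q. p \<noteq> q \<longrightarrow> \<not> compatible_in P r p q"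
    \<comment> \<open>Conditions with the same first component are compatible, by uniting the second
      components. An antichain thus injects into the finite subsets of the countable set
      \<open>I\<close>.\<close>
    have "inj_on fst Q"
    proof (rule inj_onI, rule ccontr)
      fix p q assume pq: "p \<in> Q" "q \<in> Q" "fst p = fst q" "p \<noteq> q"
      obtain s F F' where eq: "p = (s, F)" "q = (s, F')" using pq(3) by (metis prod.collapse)
      have "(s, F \<union> F') \<in> P" "p \<in> P" "q \<in> P" using Q pq(1,2) eq unfolding P_def by auto
      then have "compatible_in P r p q"
        unfolding compatible_in_def eq r_def ext_def by (intro bexI[of _ "(s, F \<union> F')"]) auto
      then show False using anti pq by blast
    qed
    moreover have "fst ` Q \<subseteq> {s. finite s \<and> s \<subseteq> I}" using Q unfolding P_def by fastforce
    then have "countable (fst ` Q)" by (rule countable_subset) (rule countable_Collect_finite_subset[OF I])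
    ultimately show "countable Q" by (rule countable_image_inj_on[rotated])
  qed
  have dense: "dense_in_order P r (E i)" if i: "i \<in> J" for i
  proof -
    obtain d s0 where ds: "i = (d, s0)" "d \<in> D" "finite s0" "s0 \<subseteq> I" using i unfolding J_def by blast
    have "\<exists>p'\<in>E i. (p', p) \<in> r" if p: "p \<in> P" for p
    proof -
      obtain s F where sF: "p = (s, F)" "finite s" "s \<subseteq> I" "finite F" "F \<subseteq> D"
        using p unfolding P_def by blast
      have "infinite (I \<inter> A d - (\<Union>e\<in>F. \<Union>e'\<in>F - {e}. A e \<inter> A e') - (s \<union> s0))"
        using inf[OF ds(2) sF(4,5)] sF(2) ds(3) by (simp add: Diff_infinite_finite)
      from infinite_imp_nonempty[OF this]
      obtain c where "c \<in> I \<inter> A d - (\<Union>e\<in>F. \<Union>e'\<in>F - {e}. A e \<inter> A e') - (s \<union> s0)"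
        by (elim ex_in_conv[THEN iffD2, THEN exE])
      then have c: "c \<in> I" "c \<in> A d" "c \<notin> (\<Union>e\<in>F. \<Union>e'\<in>F - {e}. A e \<inter> A e')" "c \<notin> s" "c \<notin> s0"
        by simp_all
      have "(insert c s, insert d F) \<in> P" using sF c ds unfolding P_def by blast
      moreover from this have "((insert c s, insert d F), p) \<in> r"
        using p c(3) unfolding r_def ext_def sF(1) by blast
      moreover have "(insert c s, insert d F) \<in> E i"
        using calculation(1) c unfolding E_def ds(1) by blast
      ultimately show ?thesis by blast
    qed
    then show ?thesis unfolding dense_in_order_def E_def ds(1) by blast
  qed
  have J: "J \<prec> (UNIV :: real set)"
    unfolding J_def
    using infinite_times_countable_lepoll[OF D(1) countable_Collect_finite_subset[OF I]] D(2)
    by (rule lesspoll_trans1)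
  obtain G where G: "filter_in_order P r G" "\<forall>i\<in>J. G \<inter> E i \<noteq> {}"
    using MA_generic_filter[where E = E, OF MA ne po ccc dense J] by blast
  have GP: "G \<subseteq> P" and dir: "\<And>p q. p \<in> G \<Longrightarrow> q \<in> G \<Longrightarrow> \<exists>t\<in>G. (t, p) \<in> r \<and> (t, q) \<in> r"
    using G(1) unfolding filter_in_order_def by blast+
  define C where "C = \<Union>(fst ` G)"
  have GI: "finite (fst p) \<and> fst p \<subseteq> I" if "p \<in> G" for p
    using subsetD[OF GP that] unfolding P_def by auto
  then have "C \<subseteq> I" unfolding C_def by blast
  moreover have "infinite (C \<inter> A d)" if d: "d \<in> D" for d
  proof
    assume fin: "finite (C \<inter> A d)"
    then have "(d, C \<inter> A d) \<in> J" using d \<open>C \<subseteq> I\<close> unfolding J_def by blast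
    then obtain p where p: "p \<in> G" "p \<in> E (d, C \<inter> A d)" using G(2) by blast
    then have "\<not> fst p \<inter> A d \<subseteq> C \<inter> A d" unfolding E_def by auto
    then show False using p(1) unfolding C_def by blast
  qed
  moreover have "finite (C \<inter> A d \<inter> A e)" if de: "d \<in> D" "e \<in> D" "d \<noteq> e" for d e
  proof -
    have "(d, {}) \<in> J" "(e, {}) \<in> J" using de unfolding J_def by auto
    then obtain p q where pq: "p \<in> G" "q \<in> G" "d \<in> snd p" "e \<in> snd q"
      using bspec[OF G(2), of "(d, {})"] bspec[OF G(2), of "(e, {})"] unfolding E_def by fastforce
    obtain t where t: "t \<in> G" "(t, p) \<in> r" "(t, q) \<in> r" using dir pq by blast
    then have det: "d \<in> snd t" "e \<in> snd t" using pq unfolding r_def ext_def by auto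
    \<comment> \<open>Once a condition \<open>t\<close> of the filter lists both \<open>d\<close>
      and \<open>e\<close>, no extension of it may add a point of
      \<open>A d \<inter> A e\<close>.\<close>
    have "C \<inter> A d \<inter> A e \<subseteq> fst t"
    proof
      fix c assume c: "c \<in> C \<inter> A d \<inter> A e"
      then obtain u where u: "u \<in> G" "c \<in> fst u" unfolding C_def by blast
      obtain v where v: "v \<in> G" "(v, t) \<in> r" "(v, u) \<in> r" using dir t(1) u(1) by blast
      have "c \<in> fst v" using v(3) u(2) unfolding r_def ext_def by auto
      moreover have "(fst v - fst t) \<inter> (\<Union>e\<in>snd t. \<Union>e'\<in>snd t - {e}. A e \<inter> A e') = {}"
        using v(2) unfolding r_def ext_def by (simp add: case_prod_beta)
      then have "(fst v - fst t) \<inter> (A d \<inter> A e) = {}" using det de(3) by blast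
      ultimately show "c \<in> fst t" using c by blast
    qed
    moreover have "finite (fst t)" using GI[OF t(1)] by simp
    ultimately show ?thesis by (rule finite_subset)
  qed
  ultimately show ?thesis by blast
qed

section \<open>Countability of discrete subsets\<close>

text \<open>The remainder \<open>R\<close> of the set \<open>C\<close> in its closure meets every
  \<open>V d\<close>, because \<open>C \<inter> V d\<close> is infinite, while distinct
  \<open>V d\<close> are disjoint on \<open>R\<close>, because
  \<open>C \<inter> V d \<inter> V e\<close> is finite. A countable dense subset of \<open>R\<close>
  would need a separate point for each of uncountably many \<open>d\<close>.\<close>

lemma countable_discrete_subset:
  assumes MA: "martins_axiom TYPE(real)" and nCH: "\<not> continuum_hypothesis"
    and sc: "scattered_space X" and comp: "compact_space X" and haus: "Hausdorff_space X"
    and sep: "separable_space X" and hsc: "hereditarily_supercompact_space X"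
    and DX: "D \<subseteq> topspace X" and disc: "\<And>d. d \<in> D \<Longrightarrow> \<exists>U. openin X U \<and> U \<inter> D = {d}"
  shows "countable D"
proof (rule ccontr)
  assume unc: "uncountable D"
  have zd: "zero_dimensional_space X"
    using sc comp haus by (rule scattered_compact_Hausdorff_imp_zero_dimensional)
  define I where "I = {x. openin X {x}}"
  have IX: "I \<subseteq> topspace X" unfolding I_def using openin_subset by blast
  have cI: "countable I"
  proof -
    obtain Z where Z: "countable Z" "Z \<subseteq> topspace X" "X closure_of Z = topspace X"
      using sep unfolding separable_space_def by blast
    have "x \<in> Z" if x: "x \<in> I" for x
    proof -
      have "x \<in> X closure_of Z" using x IX Z(3) by blast
      then show ?thesis using x unfolding in_closure_of I_def by blast
    qed
    then show ?thesis using countable_subset[OF _ Z(1), of I] by blast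
  qed
  have dI: "U \<inter> I \<noteq> {}" if U: "openin X U" "U \<noteq> {}" for U
  proof -
    have "U \<subseteq> topspace X" using U(1) by (rule openin_subset)
    then obtain x where x: "x \<in> U" "openin (subtopology X U) {x}"
      using sc U(2) unfolding scattered_space_def by blast
    then have "openin X {x}" using openin_trans_full[OF x(2) U(1)] by blast
    then show ?thesis using x(1) unfolding I_def by blast
  qed
  \<comment> \<open>An isolated point could have a singleton neighbourhood; for the other points
    every neighbourhood contains infinitely many points of \<open>I\<close>.\<close>
  have "uncountable (D - I)" using unc cI by (simp add: uncountable_minus_countable)
  then obtain E where E: "E \<subseteq> D - I" "uncountable E" "E \<prec> (UNIV :: real set)"
    using uncountable_subset_lesspoll_real[OF nCH] by blast
  have "\<exists>V. openin X V \<and> closedin X V \<and> V \<inter> E = {d}" if d: "d \<in> E" for d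
  proof -
    obtain U where U: "openin X U" "U \<inter> D = {d}" using disc d E(1) by blast
    then obtain V where V: "openin X V" "closedin X V" "d \<in> V" "V \<subseteq> U"
      using zd unfolding zero_dimensional_space_def by blast
    then have "V \<inter> E = {d}" using U(2) d E(1) by blast
    then show ?thesis using V by blast
  qed
  then obtain V where V: "\<And>d. d \<in> E \<Longrightarrow> openin X (V d) \<and> closedin X (V d) \<and> V d \<inter> E = {d}" by metis
  have inf: "infinite (I \<inter> V d - (\<Union>e\<in>F. \<Union>e'\<in>F - {e}. V e \<inter> V e'))"
    if d: "d \<in> E" and F: "finite F" "F \<subseteq> E" for d F
  proof
    \<comment> \<open>The open set \<open>N\<close> still contains \<open>d\<close>, which lies in
      no \<open>V e\<close> with \<open>e \<in> F\<close> other than \<open>V d\<close>. If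
      \<open>I \<inter> N\<close> were finite, deleting it would leave an open set that contains
      \<open>d\<close> but misses the dense set \<open>I\<close>.\<close>
    define N where "N = V d - (\<Union>e\<in>F. \<Union>e'\<in>F - {e}. V e \<inter> V e')"
    assume fin: "finite (I \<inter> V d - (\<Union>e\<in>F. \<Union>e'\<in>F - {e}. V e \<inter> V e'))"
    have "closedin X (V e \<inter> V e')" if e: "e \<in> F" "e' \<in> F - {e}" for e e'
      using V[of e] V[of e'] e F(2) by (intro closedin_Int) auto
    then have "closedin X (\<Union>e'\<in>F - {e}. V e \<inter> V e')" if "e \<in> F" for e
      using F(1) that by (intro closedin_Union) blast+
    then have "closedin X (\<Union>e\<in>F. \<Union>e'\<in>F - {e}. V e \<inter> V e')"
      using F(1) by (intro closedin_Union) blast+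
    then have "openin X N" unfolding N_def using V[OF d] by (intro openin_diff) simp_all
    moreover have "closedin X (I \<inter> N)"
      using fin IX closedin_Hausdorff_finite[OF haus] unfolding N_def by (metis (no_types, lifting) Int_Diff Int_lower1 subset_trans)
    ultimately have "openin X (N - I \<inter> N)" by (rule openin_diff)
    moreover have "(N - I \<inter> N) \<inter> I = {}" by blast
    ultimately have "N - I \<inter> N = {}" using dI[of "N - I \<inter> N"] by metis
    moreover have "d \<in> N"
    proof -
      have "d \<in> V d" using V[OF d] by blast
      moreover have "e = d" if "e \<in> F" "d \<in> V e" for e
      proof -
        have "e \<in> E" using that(1) F(2) by (rule subsetD[rotated])
        then have "V e \<inter> E = {e}" using V by simp
        then show ?thesis using that(2) d by auto
      qed
      ultimately show ?thesis unfolding N_def by blast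
    qed
    ultimately show False using E(1) d by blast
  qed
  have "infinite E" using E(2) countable_finite[of E] by blast
  then have "\<exists>C\<subseteq>I. (\<forall>d\<in>E. infinite (C \<inter> V d)) \<and> (\<forall>d\<in>E. \<forall>e\<in>E. d \<noteq> e \<longrightarrow> finite (C \<inter> V d \<inter> V e))"
    using E(3) inf by (intro MA_almost_disjoint_refinement[OF MA cI])
  then obtain C where CI: "C \<subseteq> I" and "\<forall>d\<in>E. infinite (C \<inter> V d)"
      "\<forall>d\<in>E. \<forall>e\<in>E. d \<noteq> e \<longrightarrow> finite (C \<inter> V d \<inter> V e)"
    by (elim exE conjE)
  then have Cinf: "\<And>d. d \<in> E \<Longrightarrow> infinite (C \<inter> V d)"
    and Cfin: "\<And>d e. d \<in> E \<Longrightarrow> e \<in> E \<Longrightarrow> d \<noteq> e \<Longrightarrow> finite (C \<inter> V d \<inter> V e)" by simp_all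
  define Y where "Y = X closure_of C"
  define R where "R = Y - C"
  have CX: "C \<subseteq> topspace X" using CI IX by blast
  have CY: "C \<subseteq> Y" unfolding Y_def using CX closure_of_subset by blast
  have Y: "closedin X Y" "Y \<subseteq> topspace X" unfolding Y_def by (simp_all add: closure_of_subset_topspace)
  have tY: "topspace (subtopology X Y) = Y" using Y by auto
  have "openin X C"
  proof -
    have "C = \<Union>((\<lambda>x. {x}) ` C)" by blast
    also have "openin X \<dots>" using CI unfolding I_def by (intro openin_Union) auto
    finally show ?thesis .
  qed
  then have Rcl: "closedin X R" unfolding R_def using Y(1) by blast
  then have RY: "closedin (subtopology X Y) R"
    by (metis R_def Diff_subset closedin_closed_subtopology Y(1))
  have "\<exists>Q. countable Q \<and> Q \<subseteq> R \<and>
      (\<forall>V. openin (subtopology X Y) V \<and> V \<inter> R \<noteq> {} \<longrightarrow> V \<inter> Q \<noteq> {})"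
  proof (rule supercompact_separable_remainder)
    show "supercompact_space (subtopology X Y)"
      using hsc Y(1) unfolding hereditarily_supercompact_space_def by blast
    show "compact_space (subtopology X Y)"
      using comp Y(1) closedin_compact_space compact_space_subtopology by blast
    show "zero_dimensional_space (subtopology X Y)" using zd by (rule zero_dimensional_subtopology)
    have "Y - R = C" using CY unfolding R_def by blast
    then show "countable (topspace (subtopology X Y) - R)"
      unfolding tY using countable_subset[OF CI cI] by simp
    show "subtopology X Y closure_of (topspace (subtopology X Y) - R) = topspace (subtopology X Y)"
      unfolding tY \<open>Y - R = C\<close> using CY by (simp add: closure_of_subtopology Int_absorb1 flip: Y_def)
  qed (rule RY)
  then obtain Q where Q: "countable Q" "Q \<subseteq> R"
    "\<forall>V. openin (subtopology X Y) V \<and> V \<inter> R \<noteq> {} \<longrightarrow> V \<inter> Q \<noteq> {}" by (elim exE conjE)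
  have "\<exists>q. q \<in> V d \<inter> Q" if d: "d \<in> E" for d
  proof -
    \<comment> \<open>Otherwise \<open>C \<inter> V d\<close> would be closed, hence a compact
      infinite set of isolated points.\<close>
    have "V d \<inter> R \<noteq> {}"
    proof
      assume e: "V d \<inter> R = {}"
      have "V d \<inter> Y = C \<inter> V d" using e CY unfolding R_def by blast
      then have "closedin X (C \<inter> V d)" using V[OF d] Y(1) closedin_Int by metis
      then have "compactin X (C \<inter> V d)" using comp closedin_compact_space by blast
      moreover have "C \<inter> V d \<subseteq> \<Union>((\<lambda>x. {x}) ` (C \<inter> V d))" by blast
      moreover have "\<And>U. U \<in> (\<lambda>x. {x}) ` (C \<inter> V d) \<Longrightarrow> openin X U" using CI unfolding I_def by blast
      ultimately obtain \<F> where "finite \<F>" "\<F> \<subseteq> (\<lambda>x. {x}) ` (C \<inter> V d)" "C \<inter> V d \<subseteq> \<Union>\<F>"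
        using compactinD[of X "C \<inter> V d" "(\<lambda>x. {x}) ` (C \<inter> V d)"] by blast
      then have "finite (C \<inter> V d)" by (intro finite_subset[of "C \<inter> V d" "\<Union>\<F>"] finite_Union) auto
      then show False using Cinf[OF d] by blast
    qed
    then have "V d \<inter> Y \<inter> R \<noteq> {}" unfolding R_def by blast
    moreover have "openin (subtopology X Y) (V d \<inter> Y)" using V[OF d] by (simp add: openin_subtopology_Int)
    ultimately have "V d \<inter> Y \<inter> Q \<noteq> {}" using Q(3) by simp
    then show ?thesis by blast
  qed
  then obtain q where q: "\<And>d. d \<in> E \<Longrightarrow> q d \<in> V d \<inter> Q" by metis
  have "inj_on q E"
  proof (rule inj_onI, rule ccontr)
    fix d e assume de: "d \<in> E" "e \<in> E" "q d = q e" "d \<noteq> e"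
    let ?S = "C \<inter> V d \<inter> V e"
    have qd: "q d \<in> V d \<inter> V e" "q d \<in> Y" "q d \<notin> C" using q[OF de(1)] q[OF de(2)] de(3) Q(2) unfolding R_def by auto
    have "openin X (V d \<inter> V e - ?S)"
    proof (rule openin_diff)
      show "openin X (V d \<inter> V e)" using V de by (simp add: openin_Int)
      show "closedin X ?S" using Cfin[OF de(1,2,4)] CX by (intro closedin_Hausdorff_finite[OF haus]) auto
    qed
    moreover have "q d \<in> V d \<inter> V e - ?S" using qd by blast
    ultimately have "\<exists>y\<in>C. y \<in> V d \<inter> V e - ?S"
      using qd(2) unfolding Y_def by (intro closure_of_meets_open)
    then show False by blast
  qed
  moreover have "q ` E \<subseteq> Q" using q by blast
  ultimately show False using E(2) countable_image_inj_on[of q E] countable_subset[OF _ Q(1), of "q ` E"] by blast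
qed

section \<open>Countable tightness and the main theorem\<close>

text \<open>Countable tightness is used in the form that all such sets are closed.\<close>

definition countably_closed_in :: "'a topology \<Rightarrow> 'a set \<Rightarrow> bool" where
  "countably_closed_in X A \<longleftrightarrow>
     A \<subseteq> topspace X \<and> (\<forall>M\<subseteq>A. countable M \<longrightarrow> X closure_of M \<subseteq> A)"

text \<open>A stand-in for the first uncountable ordinal: well-order the reals and cut at the least
  element with uncountably many predecessors, if there is one.\<close>

lemma omega1_like_wellorder:
  "\<exists>(B :: real set) R. uncountable B \<and> wf R \<and> (\<forall>x. countable {y. (y, x) \<in> R}) \<and>
     (\<forall>x\<in>B. \<forall>y\<in>B. x \<noteq> y \<longrightarrow> (x, y) \<in> R \<or> (y, x) \<in> R)"
proof -
  obtain r :: "real rel" where r: "well_order_on UNIV r" using well_order_on by blast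
  define R where "R = r - Id"
  have wf: "wf R" and tot: "\<And>x y. x \<noteq> y \<Longrightarrow> (x, y) \<in> R \<or> (y, x) \<in> R"
    using r unfolding R_def well_order_on_def linear_order_on_def total_on_def by auto
  show ?thesis
  proof (cases "\<forall>x. countable {y. (y, x) \<in> R}")
    case True
    then show ?thesis using wf tot uncountable_UNIV_real by (intro exI[of _ UNIV] exI[of _ R]) simp
  next
    case False
    then obtain x0 where "x0 \<in> {x. uncountable {y. (y, x) \<in> R}}" by blast
    then obtain x where "x \<in> {x. uncountable {y. (y, x) \<in> R}}"
      "\<forall>y. (y, x) \<in> R \<longrightarrow> y \<notin> {x. uncountable {y. (y, x) \<in> R}}"
      using wf[unfolded wf_eq_minimal] by meson
    then have x: "uncountable {y. (y, x) \<in> R}"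
      "\<And>y. (y, x) \<in> R \<Longrightarrow> countable {z. (z, y) \<in> R}" by simp_all
    define B where "B = {y. (y, x) \<in> R}"
    have "countable {z. (z, y) \<in> R \<inter> B \<times> B}" for y
    proof (cases "y \<in> B")
      case True
      then have "countable {z. (z, y) \<in> R}" using x(2) unfolding B_def by simp
      then show ?thesis by (rule countable_subset[rotated]) blast
    qed simp
    moreover have "wf (R \<inter> B \<times> B)" using wf by (rule wf_subset) blast
    moreover have "\<forall>y\<in>B. \<forall>z\<in>B. y \<noteq> z \<longrightarrow> (y, z) \<in> R \<inter> B \<times> B \<or> (z, y) \<in> R \<inter> B \<times> B"
      using tot by blast
    ultimately show ?thesis using x(1) unfolding B_def[symmetric]
      by (intro exI[of _ B] exI[of _ "R \<inter> B \<times> B"]) simp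
  qed
qed

text \<open>A countable intersection of neighbourhoods of \<open>z\<close> need not be open, so
  closure alone gives only points \<open>a k\<close> in the first \<open>k + 1\<close> of them. A
  common point of the closures of the tails lies in all of them, and in \<open>A\<close> because
  \<open>A\<close> is countably closed.\<close>

lemma countably_closed_meets_countable_Inter:
  assumes comp: "compact_space X" and A: "countably_closed_in X A" and z: "z \<in> X closure_of A"
    and cnt: "countable \<N>" and N: "\<And>N. N \<in> \<N> \<Longrightarrow> openin X N \<and> closedin X N \<and> z \<in> N"
  shows "\<exists>x\<in>A. \<forall>N\<in>\<N>. x \<in> N"
proof -
  have zX: "z \<in> topspace X" using z unfolding in_closure_of by simp
  have "countable (insert (topspace X) \<N>)" "insert (topspace X) \<N> \<noteq> {}" using cnt by auto
  then have "\<exists>N' :: nat \<Rightarrow> 'a set. range N' = insert (topspace X) \<N>"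
    using uncountable_def[of "insert (topspace X) \<N>"] by blast
  then obtain N' :: "nat \<Rightarrow> 'a set" where N': "range N' = insert (topspace X) \<N>" by blast
  have clopen: "openin X (N' i) \<and> closedin X (N' i) \<and> z \<in> N' i" for i
  proof -
    have "N' i \<in> insert (topspace X) \<N>" using N' by blast
    then show ?thesis using N zX by auto
  qed
  have "\<exists>a\<in>A. \<forall>i\<le>k. a \<in> N' i" for k
  proof -
    have "openin X (\<Inter>(N' ` {..k}))" using clopen by (intro openin_Inter) auto
    moreover have "z \<in> \<Inter>(N' ` {..k})" using clopen by blast
    ultimately have "\<exists>a\<in>A. a \<in> \<Inter>(N' ` {..k})" using z by (rule closure_of_meets_open)
    then show ?thesis by auto
  qed
  then obtain a where a: "\<And>k. a k \<in> A" "\<And>k i. i \<le> k \<Longrightarrow> a k \<in> N' i" by metis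
  define C where "C k = X closure_of (a ` {k..})" for k
  have aX: "a k \<in> topspace X" for k using a(1) A unfolding countably_closed_in_def by blast
  have CA: "C k \<subseteq> A" for k
  proof -
    have "a ` {k..} \<subseteq> A" "countable (a ` {k..})" using a(1) by auto
    then show ?thesis using A unfolding countably_closed_in_def C_def by simp
  qed
  have CN: "C k \<subseteq> N' k" for k
    unfolding C_def using a(2) clopen by (intro closure_of_minimal) auto
  have aC: "a j \<in> C k" if "k \<le> j" for j k
    using closure_of_subset[of "a ` {k..}" X] aX that unfolding C_def by auto
  have "topspace X \<inter> \<Inter>(range C) \<noteq> {}"
  proof
    assume e: "topspace X \<inter> \<Inter>(range C) = {}"
    have cl: "\<And>D. D \<in> range C \<Longrightarrow> closedin X D" unfolding C_def by auto
    obtain \<F> where F: "finite \<F>" "\<F> \<subseteq> range C" "topspace X \<inter> \<Inter>\<F> \<subseteq> {}"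
      using compact_space_Inter_subset_open[OF comp cl openin_empty, of "range C"] e by auto
    obtain J where J: "finite J" "\<F> = C ` J" using finite_subset_image[OF F(1,2)] by blast
    obtain k where k: "\<forall>j\<in>J. j \<le> k" using J(1) finite_nat_set_iff_bounded_le by blast
    then have "a k \<in> topspace X \<inter> \<Inter>\<F>" using aC aX J(2) by auto
    then show False using F(3) by blast
  qed
  then obtain x where x: "\<And>k. x \<in> C k" by blast
  have "x \<in> N" if "N \<in> \<N>" for N
  proof -
    have "N \<in> range N'" using N' that by blast
    then show ?thesis using x CN by blast
  qed
  then show ?thesis using x CA by blast
qed

lemma countably_closed_imp_closed:
  assumes comp: "compact_space X" and haus: "Hausdorff_space X" and zd: "zero_dimensional_space X"
    and disc: "\<And>D. D \<subseteq> topspace X \<Longrightarrow> (\<And>d. d \<in> D \<Longrightarrow> \<exists>U. openin X U \<and> U \<inter> D = {d}) \<Longrightarrow> countable D"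
    and A: "countably_closed_in X A"
  shows "closedin X A"
proof (rule ccontr)
  assume "\<not> closedin X A"
  moreover have AX: "A \<subseteq> topspace X" using A unfolding countably_closed_in_def by blast
  ultimately obtain z where z: "z \<in> X closure_of A" "z \<notin> A"
    using closure_of_subset_eq by blast
  have zX: "z \<in> topspace X" using z unfolding in_closure_of by simp
  \<comment> \<open>An uncountable free sequence \<open>x b\<close> in \<open>A\<close>: \<open>N b\<close> contains all later points and
    \<open>N' b\<close> misses all earlier ones.\<close>
  obtain B :: "real set" and R where B: "uncountable B" "wf R" "\<And>x. countable {y. (y, x) \<in> R}"
    "\<And>x y. x \<in> B \<Longrightarrow> y \<in> B \<Longrightarrow> x \<noteq> y \<Longrightarrow> (x, y) \<in> R \<or> (y, x) \<in> R"
    using omega1_like_wellorder by metis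
  define P where "P f b t = (case t of (x, N', N) \<Rightarrow>
      x \<in> A \<and> openin X N' \<and> closedin X N' \<and> openin X N \<and> closedin X N \<and> z \<in> N' \<and> z \<in> N \<and>
      x \<in> N' \<and> x \<notin> N \<and> (\<forall>c. (c, b) \<in> R \<longrightarrow> fst (f c) \<notin> N' \<and> x \<in> snd (snd (f c))))"
    for f :: "real \<Rightarrow> 'a \<times> 'a set \<times> 'a set" and b t
  have "\<exists>f. \<forall>b. P f b (f b)"
  proof (rule dependent_wf_choice[OF B(2)])
    fix f g :: "real \<Rightarrow> 'a \<times> 'a set \<times> 'a set" and b t
    assume "\<And>c. (c, b) \<in> R \<Longrightarrow> f c = g c"
    then show "P f b t = P g b t" unfolding P_def by (auto split: prod.splits)
  next
    fix b and f :: "real \<Rightarrow> 'a \<times> 'a set \<times> 'a set"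
    assume prev: "\<And>c. (c, b) \<in> R \<Longrightarrow> P f c (f c)"
    define M where "M = (\<lambda>c. fst (f c)) ` {c. (c, b) \<in> R}"
    have fA: "fst (f c) \<in> A" and fN: "openin X (snd (snd (f c))) \<and> closedin X (snd (snd (f c))) \<and> z \<in> snd (snd (f c))"
      if "(c, b) \<in> R" for c
      using prev[OF that] unfolding P_def by (auto split: prod.splits)
    have M: "M \<subseteq> A" "countable M" using fA B(3) unfolding M_def by auto
    then have clM: "X closure_of M \<subseteq> A" using A unfolding countably_closed_in_def by blast
    have "openin X (topspace X - X closure_of M)" by auto
    moreover have "z \<in> topspace X - X closure_of M" using zX clM z(2) by blast
    ultimately obtain N' where N': "openin X N'" "closedin X N'" "z \<in> N'" "N' \<subseteq> topspace X - X closure_of M"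
      using zd unfolding zero_dimensional_space_def by metis
    have MN': "fst (f c) \<notin> N'" if "(c, b) \<in> R" for c
    proof -
      have "fst (f c) \<in> X closure_of M"
        using closure_of_subset[of M X] M(1) AX that unfolding M_def by blast
      then show ?thesis using N'(4) by blast
    qed
    define \<N> where "\<N> = insert N' ((\<lambda>c. snd (snd (f c))) ` {c. (c, b) \<in> R})"
    have "\<exists>x\<in>A. \<forall>N\<in>\<N>. x \<in> N"
    proof (rule countably_closed_meets_countable_Inter[OF comp A z(1)])
      show "countable \<N>" unfolding \<N>_def using B(3) by simp
      show "openin X N \<and> closedin X N \<and> z \<in> N" if "N \<in> \<N>" for N
        using that N' fN unfolding \<N>_def by auto
    qed
    then obtain x where x: "x \<in> A" "\<And>N. N \<in> \<N> \<Longrightarrow> x \<in> N" by blast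
    have "openin X (topspace X - {x})"
      using x(1) AX haus by (intro openin_diff openin_topspace closedin_Hausdorff_singleton) auto
    moreover have "z \<in> topspace X - {x}" using zX x(1) z(2) by blast
    ultimately obtain N where N: "openin X N" "closedin X N" "z \<in> N" "N \<subseteq> topspace X - {x}"
      using zd unfolding zero_dimensional_space_def by metis
    have "P f b (x, N', N)"
      unfolding P_def using x N' N MN' unfolding \<N>_def by auto
    then show "\<exists>t. P f b t" by blast
  qed
  then obtain f where f: "\<And>b. P f b (f b)" by blast
  define x where "x b = fst (f b)" for b
  define N' where "N' b = fst (snd (f b))" for b
  define N where "N b = snd (snd (f b))" for b
  have props: "x b \<in> A" "openin X (N' b)" "closedin X (N b)" "x b \<in> N' b" "x b \<notin> N b"
    "\<And>c. (c, b) \<in> R \<Longrightarrow> x c \<notin> N' b \<and> x b \<in> N c" for b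
    using f[of b] unfolding P_def x_def N'_def N_def by (auto simp: case_prod_beta)
  have "inj_on x B"
    using props(4,6) B(4) unfolding inj_on_def by metis
  then have "uncountable (x ` B)" using B(1) countable_image_inj_on by blast
  moreover have "countable (x ` B)"
  proof (rule disc)
    show "x ` B \<subseteq> topspace X" using props(1) AX by blast
    fix d assume "d \<in> x ` B"
    then obtain b where b: "b \<in> B" "d = x b" by blast
    \<comment> \<open>\<open>N' b\<close> excludes the earlier points and \<open>N b\<close> absorbs
      the later ones, so their difference isolates \<open>x b\<close>.\<close>
    have "(N' b - N b) \<inter> x ` B \<subseteq> {x b}"
    proof
      fix e assume e: "e \<in> (N' b - N b) \<inter> x ` B"
      then obtain c where c: "c \<in> B" "e = x c" by blast
      then have "c = b" using B(4)[OF c(1) b(1)] props(6) e by blast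
      then show "e \<in> {x b}" using c by simp
    qed
    moreover have "x b \<in> (N' b - N b) \<inter> x ` B" using props(4,5) b by blast
    moreover have "openin X (N' b - N b)" using props(2,3) by (intro openin_diff)
    ultimately show "\<exists>U. openin X U \<and> U \<inter> x ` B = {d}" unfolding b(2) by blast
  qed
  ultimately show False by blast
qed

lemma countably_closed_product_imp_closed:
  fixes X :: "'a topology" and n :: nat
  defines "Y \<equiv> product_topology (\<lambda>_. X) {..<n}"
  assumes comp: "compact_space X" and haus: "Hausdorff_space X"
    and tight: "\<And>A. countably_closed_in X A \<Longrightarrow> closedin X A"
    and T: "countably_closed_in Y T"
  shows "closedin Y T"
proof -
  have compP: "compact_space Y" unfolding Y_def using comp by (simp add: compact_space_product_topology)
  have hausP: "Hausdorff_space Y" unfolding Y_def using haus by (simp add: Hausdorff_space_product_topology)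
  have reg: "neighbourhood_base_of (closedin Y) Y"
    using compact_Hausdorff_imp_regular_space[OF compP hausP] neighbourhood_base_of_closedin by blast
  have proj: "continuous_map Y X (\<lambda>f. f k)" if "k < n" for k
    unfolding Y_def using continuous_map_product_projection[of k "{..<n}" "\<lambda>_. X"] that by simp
  have TP: "T \<subseteq> topspace Y" and Tcl: "\<And>M. M \<subseteq> T \<Longrightarrow> countable M \<Longrightarrow> Y closure_of M \<subseteq> T"
    using T unfolding countably_closed_in_def by auto
  have "z \<in> T" if z: "z \<in> Y closure_of T" for z
  proof -
    have zP: "z \<in> topspace Y" using z unfolding in_closure_of by simp
    \<comment> \<open>Fix the coordinates of \<open>z\<close> one at a time, using countable tightness of \<open>X\<close> for the projection
      to coordinate \<open>k\<close> at each step.\<close>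
    have "z \<in> Y closure_of {f \<in> T. \<forall>i<k. f i = z i}" if "k \<le> n" for k
      using that
    proof (induction k)
      case 0
      then show ?case using z by simp
    next
      case (Suc k)
      define Tk where "Tk = {f \<in> T. \<forall>i<k. f i = z i}"
      have k: "k < n" and IH: "z \<in> Y closure_of Tk" using Suc unfolding Tk_def by auto
      have TkT: "Tk \<subseteq> T" unfolding Tk_def by blast
      have "\<exists>f\<in>{f \<in> T. \<forall>i<Suc k. f i = z i}. f \<in> N" if N: "openin Y N" "z \<in> N" for N
      proof -
        obtain U V where UV: "openin Y U" "closedin Y V" "z \<in> U" "U \<subseteq> V" "V \<subseteq> N"
          using reg N unfolding neighbourhood_base_of by metis
        \<comment> \<open>The closed set \<open>V\<close> keeps \<open>S\<close> countably closed,
          while the open set \<open>U\<close> inside it guarantees points of \<open>Tk\<close> near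
          \<open>z\<close>.\<close>
        define S where "S = Tk \<inter> V"
        have fib: "Y closure_of M \<subseteq> S" if M: "M \<subseteq> S" "countable M" for M
        proof
          fix f assume f: "f \<in> Y closure_of M"
          have "f \<in> T" using f Tcl[of M] M TkT unfolding S_def by blast
          moreover have "f \<in> V" using f closure_of_minimal[of M V Y] M UV(2) unfolding S_def by blast
          moreover have "f i = z i" if i: "i < k" for i
          proof -
            have "z i \<in> topspace X" using zP i k unfolding Y_def by (auto simp: PiE_iff)
            then have "closedin Y {g \<in> topspace Y. g i \<in> {z i}}"
              using proj[of i] i k haus
              by (intro closedin_continuous_map_preimage[of Y X] closedin_Hausdorff_singleton) auto
            moreover have "M \<subseteq> {g \<in> topspace Y. g i \<in> {z i}}"
              using M(1) TP i unfolding S_def Tk_def by auto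
            ultimately have "f \<in> {g \<in> topspace Y. g i \<in> {z i}}"
              using f closure_of_minimal by blast
            then show ?thesis by simp
          qed
          ultimately show "f \<in> S" unfolding S_def Tk_def by blast
        qed
        define A where "A = (\<lambda>f. f k) ` S"
        have SP: "S \<subseteq> topspace Y" using TP TkT unfolding S_def by blast
        have "countably_closed_in X A"
          unfolding countably_closed_in_def
        proof (intro conjI allI impI)
          show "A \<subseteq> topspace X"
            using SP continuous_map_image_subset_topspace[OF proj[OF k]] unfolding A_def by blast
          fix M assume M: "M \<subseteq> A" "countable M"
          then obtain M' where M': "countable M'" "M' \<subseteq> S" "M = (\<lambda>f. f k) ` M'"
            unfolding A_def by (metis countable_subset_image)
          \<comment> \<open>Compactness makes the projection closed, so limits of a countable set of
            coordinates lift to limits of a countable subset of \<open>S\<close>.\<close>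
          have "closed_map Y X (\<lambda>f. f k)"
            using continuous_imp_closed_map[OF proj[OF k] compP haus] .
          then have "closedin X ((\<lambda>f. f k) ` (Y closure_of M'))"
            unfolding closed_map_def by simp
          moreover have "M \<subseteq> (\<lambda>f. f k) ` (Y closure_of M')"
            unfolding M'(3) using closure_of_subset[of M' Y] M'(2) SP by blast
          ultimately have "X closure_of M \<subseteq> (\<lambda>f. f k) ` (Y closure_of M')"
            by (rule closure_of_minimal[rotated])
          then show "X closure_of M \<subseteq> A" using fib[OF M'(2,1)] unfolding A_def by blast
        qed
        then have clA: "closedin X A" by (rule tight)
        have "z k \<in> A"
        proof (rule ccontr)
          assume zk: "z k \<notin> A"
          define O' where "O' = {f \<in> topspace Y. f k \<in> topspace X - A}"
          have "openin Y O'" unfolding O'_def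
            by (rule openin_continuous_map_preimage[OF proj[OF k]]) (use clA in auto)
          then have "openin Y (U \<inter> O')" using UV(1) by (simp add: openin_Int)
          moreover have "z \<in> U \<inter> O'"
            using UV(3) zP zk k unfolding O'_def Y_def by (auto simp: PiE_iff)
          ultimately have "\<exists>f\<in>Tk. f \<in> U \<inter> O'" using IH by (rule closure_of_meets_open)
          then obtain f where f: "f \<in> Tk" "f \<in> U" "f \<in> O'" by blast
          then have "f k \<in> A" using UV(4) unfolding A_def S_def by blast
          then show False using f(3) unfolding O'_def by blast
        qed
        then obtain f where f: "f \<in> S" "f k = z k" unfolding A_def by auto
        then have "f \<in> {f \<in> T. \<forall>i<Suc k. f i = z i}" unfolding S_def Tk_def by (auto simp: less_Suc_eq)
        then show ?thesis using f(1) UV(5) unfolding S_def by blast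
      qed
      then show ?case using zP unfolding in_closure_of by blast
    qed
    then have "z \<in> Y closure_of {f \<in> T. \<forall>i<n. f i = z i}" by simp
    then have "\<exists>f\<in>{f \<in> T. \<forall>i<n. f i = z i}. f \<in> topspace Y"
      using zP by (intro closure_of_meets_open[of Y "topspace Y"]) auto
    then obtain f where f: "f \<in> T" "\<And>i. i < n \<Longrightarrow> f i = z i" by blast
    have "f = z"
      by (rule PiE_ext[of _ "{..<n}" "\<lambda>_. topspace X"])
        (use f TP zP in \<open>auto simp: Y_def\<close>)
    then show ?thesis using f(1) by simp
  qed
  then have "Y closure_of T \<subseteq> T" by blast
  then show ?thesis using TP closure_of_subset_eq by blast
qed

section \<open>Delta systems\<close>

lemma uncountable_constant_card:
  assumes "uncountable \<A>"
  shows "\<exists>n. uncountable {p \<in> \<A>. (f p :: nat) = n}"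
proof (rule ccontr)
  assume "\<not> ?thesis"
  then have "countable (\<Union>n. {p \<in> \<A>. f p = n})" by simp
  moreover have "\<A> = (\<Union>n. {p \<in> \<A>. f p = n})" by blast
  ultimately show False using assms by simp
qed

text \<open>If some point lies in uncountably many members, it is removed for the induction and
  returned to the root. Otherwise a countable disjoint subfamily meets only countably many members,
  so a maximal one is uncountable and has empty root.\<close>

lemma delta_system_card:
  assumes "uncountable \<A>" and "\<And>p. p \<in> \<A> \<Longrightarrow> finite p \<and> card p = n"
  shows "\<exists>\<Q>\<subseteq>\<A>. uncountable \<Q> \<and> (\<exists>\<Delta>. \<forall>p\<in>\<Q>. \<forall>q\<in>\<Q>. p \<noteq> q \<longrightarrow> p \<inter> q = \<Delta>)"
  using assms
proof (induction n arbitrary: \<A>)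
  case 0
  then have "p = {}" if "p \<in> \<A>" for p using that card_0_eq by blast
  then have "\<A> \<subseteq> {{}}" by blast
  then show ?case using 0(1) countable_subset[of \<A> "{{}}"] by simp
next
  case (Suc n)
  show ?case
  proof (cases "\<exists>x. uncountable {p \<in> \<A>. x \<in> p}")
    case True
    then obtain x where x: "uncountable {p \<in> \<A>. x \<in> p}" by blast
    define \<A>' where "\<A>' = (\<lambda>p. p - {x}) ` {p \<in> \<A>. x \<in> p}"
    have "inj_on (\<lambda>p. p - {x}) {p \<in> \<A>. x \<in> p}" by (rule inj_onI) (metis insert_Diff mem_Collect_eq)
    then have "uncountable \<A>'" unfolding \<A>'_def using x countable_image_inj_on by blast
    moreover have "finite p \<and> card p = n" if "p \<in> \<A>'" for p
      using that Suc.prems(2) unfolding \<A>'_def by auto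
    ultimately obtain \<Q> \<Delta> where Q: "\<Q> \<subseteq> \<A>'" "uncountable \<Q>" "\<And>p q. p \<in> \<Q> \<Longrightarrow> q \<in> \<Q> \<Longrightarrow> p \<noteq> q \<Longrightarrow> p \<inter> q = \<Delta>"
      using Suc.IH[of \<A>'] by metis
    have nx: "x \<notin> p" if "p \<in> \<Q>" for p using Q(1) that unfolding \<A>'_def by blast
    have "insert x ` \<Q> \<subseteq> \<A>"
    proof
      fix p assume "p \<in> insert x ` \<Q>"
      then obtain q where "q \<in> \<A>" "x \<in> q" "p = insert x (q - {x})" using Q(1) unfolding \<A>'_def by blast
      then show "p \<in> \<A>" by (simp add: insert_absorb)
    qed
    moreover have "inj_on (insert x) \<Q>" using nx by (intro inj_onI) (metis insert_ident)
    then have "uncountable (insert x ` \<Q>)" using Q(2) countable_image_inj_on by blast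
    moreover have "\<forall>p\<in>insert x ` \<Q>. \<forall>q\<in>insert x ` \<Q>. p \<noteq> q \<longrightarrow> p \<inter> q = insert x \<Delta>"
      using Q(3) by fastforce
    ultimately show ?thesis by blast
  next
    case False
    define \<P> where "\<P> = {\<Q>. \<Q> \<subseteq> \<A> \<and> (\<forall>p\<in>\<Q>. \<forall>q\<in>\<Q>. p \<noteq> q \<longrightarrow> p \<inter> q = {})}"
    have "\<exists>M\<in>\<P>. \<forall>Q\<in>\<P>. M \<subseteq> Q \<longrightarrow> Q = M"
    proof (rule subset_Zorn')
      fix \<C> assume ch: "subset.chain \<P> \<C>"
      have "p \<inter> q = {}" if pq: "p \<in> \<Union>\<C>" "q \<in> \<Union>\<C>" "p \<noteq> q" for p q
      proof -
        obtain C D where CD: "C \<in> \<C>" "D \<in> \<C>" "p \<in> C" "q \<in> D" using pq by blast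
        then have "C \<subseteq> D \<or> D \<subseteq> C" using ch unfolding subset_chain_def by blast
        then obtain E where "E \<in> \<C>" "p \<in> E" "q \<in> E" using CD by blast
        then show ?thesis using ch pq(3) unfolding subset_chain_def \<P>_def by blast
      qed
      moreover have "\<Union>\<C> \<subseteq> \<A>" using ch unfolding subset_chain_def \<P>_def by blast
      ultimately show "\<Union>\<C> \<in> \<P>" unfolding \<P>_def by simp
    qed
    then obtain M where MP: "M \<in> \<P>" and max: "\<And>Q. Q \<in> \<P> \<Longrightarrow> M \<subseteq> Q \<Longrightarrow> Q = M" by blast
    then have M: "M \<subseteq> \<A>" "\<forall>p\<in>M. \<forall>q\<in>M. p \<noteq> q \<longrightarrow> p \<inter> q = {}" unfolding \<P>_def by simp_all
    have "uncountable M"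
    proof
      assume cM: "countable M"
      have "countable (\<Union>p\<in>M. p)"
        by (rule countable_UN[OF cM]) (use M(1) Suc.prems(2) countable_finite in blast)
      then have cUM: "countable (\<Union>M)" by simp
      have sub: "\<A> \<subseteq> (\<Union>x\<in>\<Union>M. {p \<in> \<A>. x \<in> p})"
      proof
        fix p assume p: "p \<in> \<A>"
        show "p \<in> (\<Union>x\<in>\<Union>M. {p \<in> \<A>. x \<in> p})"
        proof (rule ccontr)
          assume con: "p \<notin> (\<Union>x\<in>\<Union>M. {p \<in> \<A>. x \<in> p})"
          then have dis: "p \<inter> q = {}" "q \<inter> p = {}" if "q \<in> M" for q using p that by blast+
          then have "insert p M \<in> \<P>" using M p unfolding \<P>_def by simp
          then have "p \<in> M" using max by blast
          \<comment> \<open>\<open>dis\<close> is applied with \<open>p\<close> itself as the member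
            of \<open>M\<close>.\<close>
          then have "p = {}" using dis by blast
          then show False using Suc.prems(2)[OF p] by simp
        qed
      qed
      have "countable (\<Union>x\<in>\<Union>M. {p \<in> \<A>. x \<in> p})"
        using False by (intro countable_UN[OF cUM]) blast
      then show False using Suc.prems(1) countable_subset[OF sub] by blast
    qed
    then show ?thesis using M by blast
  qed
qed

lemma delta_system:
  assumes "uncountable \<A>" and "\<And>p. p \<in> \<A> \<Longrightarrow> finite p"
  shows "\<exists>\<Q> \<Delta>. \<Q> \<subseteq> \<A> \<and> uncountable \<Q> \<and> (\<forall>p\<in>\<Q>. \<forall>q\<in>\<Q>. p \<noteq> q \<longrightarrow> p \<inter> q = \<Delta>)"
proof -
  obtain n where n: "uncountable {p \<in> \<A>. card p = n}"
    using uncountable_constant_card[OF assms(1), of card] by blast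
  have "\<exists>\<Q>\<subseteq>{p \<in> \<A>. card p = n}. uncountable \<Q> \<and> (\<exists>\<Delta>. \<forall>p\<in>\<Q>. \<forall>q\<in>\<Q>. p \<noteq> q \<longrightarrow> p \<inter> q = \<Delta>)"
    by (rule delta_system_card[OF n]) (use assms(2) in auto)
  then obtain \<Q> \<Delta> where "\<Q> \<subseteq> {p \<in> \<A>. card p = n}" "uncountable \<Q>"
    "\<forall>p\<in>\<Q>. \<forall>q\<in>\<Q>. p \<noteq> q \<longrightarrow> p \<inter> q = \<Delta>"
    by (elim exE conjE)
  then show ?thesis by (intro exI[of _ \<Q>] exI[of _ \<Delta>]) auto
qed

section \<open>Independent sets under Martin's Axiom\<close>

lemma MA_uncountable_independent:
  assumes MA: "martins_axiom TYPE(real)"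
    and comp: "compact_space X" and haus: "Hausdorff_space X"
    and tight: "\<And>A. countably_closed_in X A \<Longrightarrow> closedin X A"
    and E: "uncountable E" "E \<prec> (UNIV :: real set)"
    and V: "\<And>x. x \<in> E \<Longrightarrow> openin X (V x) \<and> closedin X (V x) \<and> countable (V x) \<and> x \<in> V x"
  shows "\<exists>D\<subseteq>E. uncountable D \<and> (\<forall>x\<in>D. V x \<inter> D = {x})"
proof -
  \<comment> \<open>Finite partial colourings of \<open>E\<close> by natural numbers with independent colour classes.  Colouring
    all of \<open>E\<close> keeps the density argument trivial: an unused colour is always available.\<close>
  define P where "P = {p. finite p \<and> p \<subseteq> E \<times> (UNIV :: nat set) \<and>
    (\<forall>x y i. (x, i) \<in> p \<and> (y, i) \<in> p \<and> x \<noteq> y \<longrightarrow> x \<notin> V y)}"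
  define r where "r = {(p, q). p \<in> P \<and> q \<in> P \<and> q \<subseteq> p}"
  define C where "C x = {p \<in> P. x \<in> fst ` p}" for x
  have EX: "E \<subseteq> topspace X" using V openin_subset by blast
  have PD: "x \<notin> V y" if "p \<in> P" "(x, i) \<in> p" "(y, i) \<in> p" "x \<noteq> y" for p x y i
    using that unfolding P_def by blast
  have PI: "p \<in> P" if "finite p" "p \<subseteq> E \<times> UNIV" "\<And>x y i. (x, i) \<in> p \<Longrightarrow> (y, i) \<in> p \<Longrightarrow> x \<noteq> y \<Longrightarrow> x \<notin> V y" for p
    using that unfolding P_def by blast
  have Pfin: "finite p" "p \<subseteq> E \<times> UNIV" if "p \<in> P" for p using that unfolding P_def by auto
  have ne: "P \<noteq> {}" unfolding P_def by blast
  have po: "partial_order_on P r"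
    unfolding partial_order_on_def preorder_on_def refl_on_def trans_def antisym_def r_def by blast
  have dense: "dense_in_order P r (C x)" if x: "x \<in> E" for x
    unfolding dense_in_order_def
  proof (intro conjI ballI)
    show "C x \<subseteq> P" unfolding C_def by blast
    fix p assume p: "p \<in> P"
    then have "finite (snd ` p)" using Pfin by simp
    then obtain i where i: "i \<notin> snd ` p" using ex_new_if_finite infinite_UNIV_nat by blast
    have "insert (x, i) p \<in> P"
    proof (rule PI)
      show "finite (insert (x, i) p)" "insert (x, i) p \<subseteq> E \<times> UNIV" using Pfin[OF p] x by auto
      fix a b j assume ab: "(a, j) \<in> insert (x, i) p" "(b, j) \<in> insert (x, i) p" "a \<noteq> b"
      have "(c, i) \<notin> p" for c using i by (metis image_eqI snd_conv)
      then have "(a, j) \<in> p \<and> (b, j) \<in> p" using ab by auto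
      then show "a \<notin> V b" using PD[OF p] ab(3) by blast
    qed
    then show "\<exists>d\<in>C x. (d, p) \<in> r"
      using p unfolding C_def r_def by (intro bexI[of _ "insert (x, i) p"]) auto
  qed
  \<comment> \<open>The union of incompatible conditions has a conflict within one colour. Neither
    condition has it alone, so its two ends come from different sides, outside the common
    part.\<close>
  have edge: "\<exists>x y. x \<in> fst ` (p - p \<inter> q) \<and> y \<in> fst ` (q - p \<inter> q) \<and> (x \<in> V y \<or> y \<in> V x)"
    if pq: "p \<in> P" "q \<in> P" "\<not> compatible_in P r p q" for p q
  proof -
    have nP: "p \<union> q \<notin> P" using pq unfolding compatible_in_def r_def by auto
    have "\<exists>x y i. (x, i) \<in> p \<union> q \<and> (y, i) \<in> p \<union> q \<and> x \<noteq> y \<and> x \<in> V y"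
    proof (rule ccontr)
      assume "\<not> ?thesis"
      then have "p \<union> q \<in> P" using Pfin[OF pq(1)] Pfin[OF pq(2)] by (intro PI) auto
      then show False using nP by blast
    qed
    then obtain x y i where xy: "(x, i) \<in> p \<union> q" "(y, i) \<in> p \<union> q" "x \<noteq> y" "x \<in> V y"
      by (elim exE conjE)
    have "\<not> ((x, i) \<in> p \<and> (y, i) \<in> p)" "\<not> ((x, i) \<in> q \<and> (y, i) \<in> q)"
      using PD[OF pq(1)] PD[OF pq(2)] xy(3,4) by blast+
    then have "(x, i) \<in> p - p \<inter> q \<and> (y, i) \<in> q - p \<inter> q \<or> (x, i) \<in> q - p \<inter> q \<and> (y, i) \<in> p - p \<inter> q"
      using xy(1,2) by blast
    then show ?thesis using xy(4) by (metis fst_conv image_eqI)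
  qed
  have ccc: "ccc_order P r"
    unfolding ccc_order_def
  proof (intro allI impI, rule ccontr)
    fix Q assume QP: "Q \<subseteq> P" and anti: "\<forall>p\<in>Q. \<forall>q\<in>Q. p \<noteq> q \<longrightarrow> \<not> compatible_in P r p q"
      and unc: "uncountable Q"
    have finQ: "finite p" if "p \<in> Q" for p using Pfin[OF subsetD[OF QP that]] by simp
    have "\<exists>Q1 \<Delta>. Q1 \<subseteq> Q \<and> uncountable Q1 \<and> (\<forall>p\<in>Q1. \<forall>q\<in>Q1. p \<noteq> q \<longrightarrow> p \<inter> q = \<Delta>)"
      by (rule delta_system[OF unc]) (rule finQ)
    then obtain Q1 \<Delta> where Q1: "Q1 \<subseteq> Q" "uncountable Q1"
      and root: "\<forall>p\<in>Q1. \<forall>q\<in>Q1. p \<noteq> q \<longrightarrow> p \<inter> q = \<Delta>"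
      by (elim exE conjE)
    define S where "S p = fst ` (p - \<Delta>)" for p :: "('a \<times> nat) set"
    obtain n where n: "uncountable {p \<in> Q1. card (S p) = n}"
      using uncountable_constant_card[OF Q1(2), of "\<lambda>p. card (S p)"] by (elim exE)
    define Q2 where "Q2 = {p \<in> Q1. card (S p) = n}"
    have Q2: "Q2 \<subseteq> Q1" "uncountable Q2" "\<And>p. p \<in> Q2 \<Longrightarrow> card (S p) = n"
      using n unfolding Q2_def by auto
    have finS: "finite (S p)" if "p \<in> Q2" for p
      using finQ[of p] Q1(1) Q2(1) that unfolding S_def by (meson finite_Diff finite_imageI subsetD)
    have SE: "S p \<subseteq> E" if p: "p \<in> Q2" for p
    proof -
      have "p \<in> P" using p Q2(1) Q1(1) QP by blast
      from Pfin(2)[OF this] show ?thesis unfolding S_def by auto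
    qed
    have edge2: "\<exists>x y. x \<in> S p \<and> y \<in> S q \<and> (x \<in> V y \<or> y \<in> V x)"
      if pq: "p \<in> Q2" "q \<in> Q2" "p \<noteq> q" for p q
    proof -
      have pqQ: "p \<in> Q1" "q \<in> Q1" "p \<in> Q" "q \<in> Q" "p \<in> P" "q \<in> P"
        using pq Q2(1) Q1(1) QP by blast+
      then have "p \<inter> q = \<Delta>" using root pq(3) by simp
      moreover have "\<not> compatible_in P r p q" using anti pqQ pq(3) by simp
      ultimately show ?thesis using edge[OF pqQ(5,6)] unfolding S_def by simp
    qed
    \<comment> \<open>The petals \<open>p - \<Delta>\<close> are disjoint as sets of coloured
      points. A bare point can recur, but at most once for each of the countably many
      colours.\<close>
    have few: "countable {p \<in> Q2. S p \<inter> L \<noteq> {}}" if L: "countable L" for L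
    proof -
      have "{p \<in> Q2. S p \<inter> L \<noteq> {}} \<subseteq> (\<Union>z\<in>L \<times> (UNIV :: nat set). {p \<in> Q2. z \<in> p - \<Delta>})"
        unfolding S_def by force
      moreover have "countable {p \<in> Q2. z \<in> p - \<Delta>}" for z
      proof (cases "{p \<in> Q2. z \<in> p - \<Delta>} = {}")
        case False
        then obtain p where p: "p \<in> Q2" "z \<in> p - \<Delta>" by blast
        have "q = p" if "q \<in> Q2" "z \<in> q - \<Delta>" for q
          using root p that Q2(1) by blast
        then have "{p \<in> Q2. z \<in> p - \<Delta>} \<subseteq> {p}" by blast
        then show ?thesis by (rule countable_subset) simp
      next
        case True
        then show ?thesis by (simp only: countable_empty)
      qed
      then have "countable (\<Union>z\<in>L \<times> (UNIV :: nat set). {p \<in> Q2. z \<in> p - \<Delta>})"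
        using L by (intro countable_UN countable_SIGMA) auto
      ultimately show ?thesis by (rule countable_subset)
    qed
    define W where "W p = (\<Union>x\<in>S p. V x)" for p
    have W: "openin X (W p) \<and> closedin X (W p) \<and> countable (W p)" if p: "p \<in> Q2" for p
    proof -
      have "V x \<in> {U. openin X U \<and> closedin X U \<and> countable U}" if "x \<in> S p" for x
        using V SE[OF p] that by blast
      then have "openin X U \<and> closedin X U \<and> countable U" if "U \<in> V ` S p" for U using that by blast
      moreover have "finite (V ` S p)" using finS[OF p] by simp
      moreover have "countable (\<Union>x\<in>S p. V x)"
        by (rule countable_UN[OF countable_finite[OF finS[OF p]]]) (use V SE[OF p] in blast)
      ultimately show ?thesis unfolding W_def
        by (intro conjI openin_Union closedin_Union) blast+
    qed
    define Y where "Y = product_topology (\<lambda>_. X) {..<n}"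
    have "\<exists>y. y \<in> topspace Y \<and> y ` {..<n} = S p" if p: "p \<in> Q2" for p
    proof -
      obtain h where "bij_betw h {0..<card (S p)} (S p)"
        using ex_bij_betw_nat_finite[OF finS[OF p]] by blast
      then have "h ` {..<n} = S p" using Q2(3)[OF p] by (simp add: bij_betw_def atLeast0LessThan)
      then have "restrict h {..<n} ` {..<n} = S p" "restrict h {..<n} \<in> topspace Y"
        using SE[OF p] EX unfolding Y_def by (auto simp: PiE_iff)
      then show ?thesis by blast
    qed
    then obtain y where y: "\<And>p. p \<in> Q2 \<Longrightarrow> y p \<in> topspace Y" "\<And>p. p \<in> Q2 \<Longrightarrow> y p ` {..<n} = S p"
      by metis
    \<comment> \<open>Countably closed by construction, hence closed and compact by tightness of the
      power. Every point of \<open>T\<close> comes with a countable \<open>M\<close>, which leaves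
      room for a \<open>p\<close> outside it.\<close>
    define T where "T = (\<Union>M\<in>{M. M \<subseteq> Q2 \<and> countable M}. Y closure_of (y ` M))"
    have TI: "Y closure_of (y ` M) \<subseteq> T" if "M \<subseteq> Q2" "countable M" for M
      using that unfolding T_def by blast
    have TE: "\<exists>M. M \<subseteq> Q2 \<and> countable M \<and> t \<in> Y closure_of (y ` M)" if "t \<in> T" for t
      using that unfolding T_def by blast
    have ccT: "countably_closed_in Y T"
      unfolding countably_closed_in_def
    proof (intro conjI allI impI)
      show "T \<subseteq> topspace Y" unfolding T_def using closure_of_subset_topspace by (rule UN_least)
      fix K assume K: "K \<subseteq> T" "countable K"
      have "\<exists>M. M \<subseteq> Q2 \<and> countable M \<and> t \<in> Y closure_of (y ` M)" if "t \<in> K" for t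
        using TE subsetD[OF K(1) that] .
      then obtain m where m: "\<And>t. t \<in> K \<Longrightarrow> m t \<subseteq> Q2 \<and> countable (m t) \<and> t \<in> Y closure_of (y ` m t)"
        by metis
      let ?M = "\<Union>(m ` K)"
      have M: "?M \<subseteq> Q2" "countable ?M" using m K(2) by (blast, simp)
      have "K \<subseteq> Y closure_of (y ` ?M)"
      proof
        fix t assume t: "t \<in> K"
        have "Y closure_of (y ` m t) \<subseteq> Y closure_of (y ` ?M)" using t by (intro closure_of_mono) blast
        then show "t \<in> Y closure_of (y ` ?M)" using m[OF t] by blast
      qed
      then have "Y closure_of K \<subseteq> Y closure_of (y ` ?M)" by (intro closure_of_minimal) auto
      moreover have "Y closure_of (y ` ?M) \<subseteq> T" using M by (rule TI)
      ultimately show "Y closure_of K \<subseteq> T" by blast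
    qed
    have "closedin Y T"
      unfolding Y_def
      by (rule countably_closed_product_imp_closed[OF comp haus _ ccT[unfolded Y_def]]) (rule tight)
    moreover have "compact_space Y" unfolding Y_def using comp by (simp add: compact_space_product_topology)
    ultimately have cT: "compactin Y T" by (rule closedin_compact_space[rotated])
    define H where "H p = (\<Union>i<n. {f \<in> topspace Y. f i \<in> W p})" for p
    have proj: "continuous_map Y X (\<lambda>f. f i)" if "i < n" for i
      unfolding Y_def using continuous_map_product_projection[of i "{..<n}" "\<lambda>_. X"] that by simp
    have Hop: "openin Y (H p)" if p: "p \<in> Q2" for p
      unfolding H_def using W[OF p] openin_continuous_map_preimage[OF proj] by (intro openin_Union) blast
    have Hcl: "closedin Y (H p)" if p: "p \<in> Q2" for p
      unfolding H_def using W[OF p] closedin_continuous_map_preimage[OF proj] by (intro closedin_Union) blast+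
    have yH: "y q \<in> H p \<longleftrightarrow> S q \<inter> W p \<noteq> {}" if "q \<in> Q2" for p q
      unfolding H_def y(2)[OF that, symmetric] using y(1)[OF that] by auto
    have "\<exists>p\<in>Q2. f \<in> H p" if f: "f \<in> T" for f
    proof -
      obtain M where M: "M \<subseteq> Q2" "countable M" "f \<in> Y closure_of (y ` M)"
        using TE[OF f] by (elim exE conjE)
      have "countable (\<Union>(W ` M))" by (rule countable_UN[OF M(2)]) (use M(1) W in blast)
      then have "countable (M \<union> {p \<in> Q2. S p \<inter> \<Union>(W ` M) \<noteq> {}})" using M(2) few by simp
      then obtain p where p: "p \<in> Q2" "p \<notin> M" "S p \<inter> \<Union>(W ` M) = {}"
        using Q2(2) countable_subset[of Q2 "M \<union> {p \<in> Q2. S p \<inter> \<Union>(W ` M) \<noteq> {}}"] by blast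
      \<comment> \<open>As \<open>S p\<close> avoids all neighbourhoods of points occurring in
        \<open>M\<close>, each edge between \<open>p\<close> and \<open>q \<in> M\<close> must put a
        point of \<open>S q\<close> into \<open>W p\<close>.\<close>
      have "y ` M \<subseteq> H p"
      proof (rule image_subsetI)
        fix q assume q: "q \<in> M"
        then obtain a b where ab: "a \<in> S p" "b \<in> S q" "a \<in> V b \<or> b \<in> V a"
          using edge2[of p q] p M(1) by blast
        have "a \<notin> V b" using p(3) ab(1,2) q unfolding W_def by blast
        then have "b \<in> S q \<inter> W p" using ab unfolding W_def by blast
        then show "y q \<in> H p" using yH[of q p] q M(1) by blast
      qed
      then have "Y closure_of (y ` M) \<subseteq> H p" using Hcl[OF p(1)] by (rule closure_of_minimal)
      then show ?thesis using M(3) p(1) by blast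
    qed
    then have cover: "T \<subseteq> \<Union>(H ` Q2)" by blast
    have "\<exists>\<F>. finite \<F> \<and> \<F> \<subseteq> H ` Q2 \<and> T \<subseteq> \<Union>\<F>"
      by (rule compactinD[OF cT _ cover]) (use Hop in blast)
    then obtain F where F: "finite F" "F \<subseteq> Q2" "T \<subseteq> \<Union>(H ` F)"
      by (metis finite_subset_image)
    \<comment> \<open>The finite subcover makes every \<open>S q\<close> meet one fixed countable
      set, which by \<open>few\<close> only countably many can do.\<close>
    have "q \<in> {p \<in> Q2. S p \<inter> \<Union>(W ` F) \<noteq> {}}" if q: "q \<in> Q2" for q
    proof -
      have "y q \<in> Y closure_of (y ` {q})" using closure_of_subset[of "y ` {q}" Y] y(1)[OF q] by simp
      then have "y q \<in> T" using TI[of "{q}"] q by auto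
      then obtain p where p: "p \<in> F" "y q \<in> H p" using F(3) by blast
      then have "S q \<inter> W p \<noteq> {}" using yH[OF q] by simp
      then show ?thesis using p(1) q by blast
    qed
    then have "Q2 \<subseteq> {p \<in> Q2. S p \<inter> \<Union>(W ` F) \<noteq> {}}" by blast
    moreover have "countable (\<Union>(W ` F))" by (rule countable_UN[OF countable_finite[OF F(1)]]) (use F(2) W in blast)
    then have "countable {p \<in> Q2. S p \<inter> \<Union>(W ` F) \<noteq> {}}" by (rule few)
    ultimately have "countable Q2" by (rule countable_subset)
    then show False using Q2(2) by blast
  qed
  obtain G where G: "filter_in_order P r G" "\<forall>x\<in>E. G \<inter> C x \<noteq> {}"
    using MA_generic_filter[where E = C, OF MA ne po ccc dense E(2)] by blast
  have dir: "\<And>p q. p \<in> G \<Longrightarrow> q \<in> G \<Longrightarrow> \<exists>t\<in>G. (t, p) \<in> r \<and> (t, q) \<in> r"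
    using G(1) unfolding filter_in_order_def by simp
  define D where "D i = {x \<in> E. \<exists>p\<in>G. (x, i) \<in> p}" for i
  have "E \<subseteq> (\<Union>i. D i)"
  proof
    fix x assume x: "x \<in> E"
    then obtain p where "p \<in> G" "p \<in> C x" using G(2) by blast
    then obtain i where "(x, i) \<in> p" unfolding C_def by auto
    then have "x \<in> D i" using x \<open>p \<in> G\<close> unfolding D_def by blast
    then show "x \<in> (\<Union>i. D i)" by blast
  qed
  then have "\<not> (\<forall>i. countable (D i))" using E(1) countable_subset[of E "\<Union>i. D i"] by auto
  then obtain i where i: "uncountable (D i)" by blast
  have "V x \<inter> D i = {x}" if x: "x \<in> D i" for x
  proof -
    have "z = x" if z: "z \<in> V x" "z \<in> D i" for z
    proof (rule ccontr)
      assume zx: "z \<noteq> x"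
      obtain p q where pq: "p \<in> G" "(x, i) \<in> p" "q \<in> G" "(z, i) \<in> q"
        using x z(2) unfolding D_def by blast
      obtain t where t: "(t, p) \<in> r" "(t, q) \<in> r" using dir[OF pq(1,3)] by blast
      then have "t \<in> P" "(x, i) \<in> t" "(z, i) \<in> t" using pq unfolding r_def by auto
      then show False using PD[of t z i x] z(1) zx by blast
    qed
    moreover have "x \<in> V x" using x V unfolding D_def by blast
    ultimately show ?thesis using x by blast
  qed
  moreover have "D i \<subseteq> E" unfolding D_def by blast
  ultimately show ?thesis using i by blast
qed

section \<open>Countability of the space and metrizability\<close>

lemma separable_hereditarily_supercompact_imp_countable:
  assumes MA: "martins_axiom TYPE(real)" and nCH: "\<not> continuum_hypothesis"
    and sc: "scattered_space X" and comp: "compact_space X" and haus: "Hausdorff_space X"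
    and sep: "separable_space X" and hsc: "hereditarily_supercompact_space X"
  shows "countable (topspace X)"
proof -
  have zd: "zero_dimensional_space X"
    using sc comp haus by (rule scattered_compact_Hausdorff_imp_zero_dimensional)
  have disc: "countable D" if "D \<subseteq> topspace X" "\<And>d. d \<in> D \<Longrightarrow> \<exists>U. openin X U \<and> U \<inter> D = {d}" for D
    using that by (rule countable_discrete_subset[OF MA nCH sc comp haus sep hsc])
  have tight: "closedin X A" if "countably_closed_in X A" for A
    by (rule countably_closed_imp_closed[OF comp haus zd _ that]) (rule disc)
  define U where "U = {x. \<exists>V. openin X V \<and> closedin X V \<and> countable V \<and> x \<in> V}"
  have "countable U"
  proof (rule ccontr)
    assume "uncountable U"
    then obtain E where E: "E \<subseteq> U" "uncountable E" "E \<prec> (UNIV :: real set)"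
      using uncountable_subset_lesspoll_real[OF nCH] by blast
    have "\<exists>V. openin X V \<and> closedin X V \<and> countable V \<and> x \<in> V" if "x \<in> E" for x
      using E(1) that unfolding U_def by blast
    then obtain V where V: "\<And>x. x \<in> E \<Longrightarrow> openin X (V x) \<and> closedin X (V x) \<and> countable (V x) \<and> x \<in> V x"
      by metis
    have "\<exists>D\<subseteq>E. uncountable D \<and> (\<forall>x\<in>D. V x \<inter> D = {x})"
      by (rule MA_uncountable_independent[OF MA comp haus _ E(2,3)]) (use tight V in blast)+
    then obtain D where D: "D \<subseteq> E" "uncountable D" "\<forall>x\<in>D. V x \<inter> D = {x}" by (elim exE conjE)
    have "countable D"
    proof (rule disc)
      show "D \<subseteq> topspace X" using D(1) V openin_subset by blast
      show "\<exists>U. openin X U \<and> U \<inter> D = {d}" if "d \<in> D" for d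
        using that D V by (intro exI[of _ "V d"]) auto
    qed
    then show False using D(2) by blast
  qed
  moreover have "topspace X \<subseteq> U"
  proof (rule ccontr)
    assume "\<not> topspace X \<subseteq> U"
    then obtain x where x: "x \<in> topspace X - U" "openin (subtopology X (topspace X - U)) {x}"
      using sc[unfolded scattered_space_def, rule_format, of "topspace X - U"] by blast
    then obtain W where W: "openin X W" "{x} = W \<inter> (topspace X - U)"
      unfolding openin_subtopology by blast
    then obtain V where V: "openin X V" "closedin X V" "x \<in> V" "V \<subseteq> W"
      using zd[unfolded zero_dimensional_space_def, rule_format, of W x] by blast
    \<comment> \<open>Since \<open>x\<close> is isolated in the complement of \<open>U\<close>, its
      neighbourhood \<open>V\<close> adds at most \<open>x\<close> to the countable set
      \<open>U\<close>; so \<open>x\<close> already qualifies for \<open>U\<close>.\<close>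
    have "V \<subseteq> insert x U" using V(4) W openin_subset[OF V(1)] by blast
    then have "countable V" using \<open>countable U\<close> by (meson countable_insert countable_subset)
    then show False using x(1) V unfolding U_def by blast
  qed
  ultimately show ?thesis by (rule countable_subset[rotated])
qed

theorem theorem2p15:
  fixes X :: "'a topology"
  assumes "martins_axiom TYPE(real)"
    and "\<not> continuum_hypothesis"
    and "scattered_space X"
    and "compact_space X"
    and "Hausdorff_space X"
  shows "metrizable_space X \<longleftrightarrow> separable_space X \<and> hereditarily_supercompact_space X"
proof -
  have zd: "zero_dimensional_space X"
    using assms(3-5) by (rule scattered_compact_Hausdorff_imp_zero_dimensional)
  show ?thesis
  proof
    assume met: "metrizable_space X"
    show "separable_space X \<and> hereditarily_supercompact_space X"
      using compact_metrizable_zero_dimensional_imp_hereditarily_supercompact[OF assms(4) met zd]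
        compact_metrizable_imp_second_countable[OF assms(4) met] second_countable_imp_separable_space
      by blast
  next
    assume "separable_space X \<and> hereditarily_supercompact_space X"
    then have "countable (topspace X)"
      using separable_hereditarily_supercompact_imp_countable[OF assms] by blast
    then show "metrizable_space X"
      by (rule countable_compact_zero_dimensional_imp_metrizable[OF assms(4) zd assms(5)])
  qed
qed

end
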